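(* Let $m$ and $n$ be positive integers. Then, modulo $\Phi_n(q)^2$, \[ T_0(mn,(m-1)n,q)\equiv 2m-nm(2m-1)(1-q^n)+(-1)^n\bigl((1+(-1)^n)(m-1)+1\bigr)\bigl(m-nm(m-1)(1-q^n)+2m(\mathcal{A}_n(q)-1)\bigr). \]
   Context: For integers $n,k$ the $q$-binomial coefficient is ${n\brack k}={n\brack k}_q=\frac{(1-q^n)(1-q^{n-1})\cdots(1-q^{n-k+1})}{(1-q)(1-q^2)\cdots(1-q^k)}$ if $0\le k\le n$, and $0$ otherwise; ${n\brack k}_{q^2}$ denotes the same with $q$ replaced by $q^2$. The $q$-trinomial coefficient of Andrews and Baxter is \[ T_0(N,M,q)=\sum_{k=0}^{N}(-1)^k{N\brack k}_{q^2}{2N-2k\brack N-M-k}. \] $\Phi_n(q)$ is the $n$th cyclotomic polynomial. For rational functions $A(q),B(q)$ and a polynomial $P(q)\in\mathbb{Z}[q]$, $A(q)\equiv B(q)\pmod{P(q)}$ means that $A(q)-B(q)$, written as a quotient $A_1(q)/A_2(q)$, has numerator divisible by $P(q)$ and denominator coprime to $P(q)$. Define, for a positive integer $n$, \[ \mathcal{A}_n(q)=\begin{cases}(-1)^r(1+q^r)q^{r(3r-1)/2}, & n=3r,\\ (-1)^rq^{r(3r+1)/2}, & n=3r+1,\\ (-1)^{r+1}q^{(r+1)(3r+2)/2}, & n=3r+2.\end{cases} \] *)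

theory Defs
  imports Complex_Main "HOL-Computational_Algebra.Computational_Algebra"
begin

section \<open>Cyclotomic polynomials\<close>

definition primitive_roots :: "nat \<Rightarrow> complex set" where
  "primitive_roots n = {z. z ^ n = 1 \<and> (\<forall>d. 0 < d \<and> d < n \<longrightarrow> z ^ d \<noteq> 1)}"

text \<open>The description determines the polynomial for \<open>n > 0\<close>; see \<open>of_int_cyclotomic\<close> below.\<close>

definition cyclotomic :: "nat \<Rightarrow> int poly" where
  "cyclotomic n = (THE P. map_poly of_int P = (\<Prod>z\<in>primitive_roots n. [:- z, 1:]))"

lemma finite_primitive_roots: "n > 0 \<Longrightarrow> finite (primitive_roots n)"
  using finite_roots_unity[of n, where 'a = complex]
  by (rule_tac finite_subset[of _ "{z. z ^ n = 1}"]) (auto simp: primitive_roots_def)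

lemma roots_unity_eq_Union_primitive_roots:
  assumes "n > 0"
  shows "{z::complex. z ^ n = 1} = (\<Union>d\<in>{d. d dvd n}. primitive_roots d)"
proof (intro equalityI subsetI)
  fix z :: complex
  assume "z \<in> {z. z ^ n = 1}"
  hence z: "z ^ n = 1" by simp
  define d where "d = (LEAST d. 0 < d \<and> z ^ d = 1)"
  have d: "0 < d \<and> z ^ d = 1"
    unfolding d_def by (rule LeastI[of _ n]) (use z assms in auto)
  have least: "z ^ e \<noteq> 1" if "0 < e" "e < d" for e
    using not_less_Least[of e "\<lambda>d. 0 < d \<and> z ^ d = 1"] that unfolding d_def by blast
  have "z ^ n = z ^ (d * (n div d) + n mod d)" by simp
  also have "\<dots> = (z ^ d) ^ (n div d) * z ^ (n mod d)"
    by (simp only: power_add power_mult)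
  finally have "z ^ (n mod d) = 1" using z d by simp
  hence "n mod d = 0"
    using least[of "n mod d"] d by (metis mod_less_divisor neq0_conv)
  hence "d dvd n" by auto
  moreover have "z \<in> primitive_roots d"
    using d least by (auto simp: primitive_roots_def)
  ultimately show "z \<in> (\<Union>d\<in>{d. d dvd n}. primitive_roots d)" by blast
next
  fix z :: complex
  assume "z \<in> (\<Union>d\<in>{d. d dvd n}. primitive_roots d)"
  then obtain d where "d dvd n" "z ^ d = 1" by (auto simp: primitive_roots_def)
  thus "z \<in> {z. z ^ n = 1}" by (auto elim!: dvdE simp: power_mult)
qed

lemma primitive_roots_disjoint:
  assumes "d > 0" "e > 0" "d \<noteq> e"
  shows "primitive_roots d \<inter> primitive_roots e = {}"
  using assms by (auto simp: primitive_roots_def) (metis nat_neq_iff)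

lemma prod_roots_unity:
  assumes "n > 0"
  shows "(\<Prod>z\<in>{z::complex. z ^ n = 1}. [:- z, 1:]) = monom 1 n - 1"
proof -
  let ?S = "{z::complex. z ^ n = 1}"
  let ?p = "\<Prod>z\<in>?S. [:- z, 1:]"
  have fin: "finite ?S" using assms by (intro finite_roots_unity) auto
  have card: "card ?S = n" using assms by (rule card_roots_unity_eq)
  have deg: "degree ?p = n" using card by (subst degree_prod_eq_sum_degree) auto
  have lead: "lead_coeff ?p = 1" by (subst lead_coeff_prod) auto
  let ?r = "?p - (monom 1 n - 1)"
  have "?r = 0"
  proof (rule ccontr)
    assume nz: "?r \<noteq> 0"
    have "?S \<subseteq> {z. poly ?r z = 0}"
      using fin by (auto simp: poly_prod poly_monom)
    hence "n \<le> card {z. poly ?r z = 0}"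
      using card card_mono[OF poly_roots_finite[OF nz]] by metis
    also have "\<dots> \<le> degree ?r" by (rule card_poly_roots_bound[OF nz])
    finally have ge: "n \<le> degree ?r" .
    have "coeff ?r i = 0" if "i \<ge> n" for i
    proof (cases "i = n")
      case True
      thus ?thesis using deg lead assms by simp
    next
      case False
      hence "coeff ?p i = 0" using deg that by (intro coeff_eq_0) auto
      thus ?thesis using False that assms by simp
    qed
    from this[OF ge] nz show False by (metis leading_coeff_0_iff)
  qed
  thus ?thesis by simp
qed

lemma of_int_poly_mult:
  "map_poly (of_int :: int \<Rightarrow> complex) (P * Q) = map_poly of_int P * map_poly of_int Q"
  by (rule poly_eqI) (simp add: coeff_map_poly coeff_mult)

lemma of_int_poly_add:
  "map_poly (of_int :: int \<Rightarrow> complex) (P + Q) = map_poly of_int P + map_poly of_int Q"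
  by (rule poly_eqI) (simp add: coeff_map_poly)

lemma ex1_int_poly_primitive_roots:
  assumes "n > 0"
  shows "\<exists>!P. map_poly of_int P = (\<Prod>z\<in>primitive_roots n. [:- z, 1:])"
proof -
  let ?C = "\<lambda>n. \<Prod>z\<in>primitive_roots n. [:- z, 1:]"
  have inj: "P = Q" if "map_poly (of_int :: int \<Rightarrow> complex) P = map_poly of_int Q" for P Q
  proof (rule poly_eqI)
    fix i
    have "coeff (map_poly (of_int :: int \<Rightarrow> complex) P) i = coeff (map_poly of_int Q) i"
      using that by simp
    thus "coeff P i = coeff Q i" by (simp add: coeff_map_poly)
  qed
  have "\<exists>P. map_poly of_int P = ?C n"
    using assms
  proof (induction n rule: less_induct)
    case (less n)
    let ?D = "{d. d dvd n \<and> d \<noteq> n}"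
    have D: "finite ?D" "{d. d dvd n} = insert n ?D"
      using less.prems by auto
    have pos: "d > 0" "d < n" if "d \<in> ?D" for d
      using that less.prems dvd_pos_nat[of n d] dvd_imp_le[of d n] by auto
    have "\<forall>d\<in>?D. \<exists>P. map_poly of_int P = ?C d"
      using less.IH pos by blast
    then obtain F where F: "\<And>d. d \<in> ?D \<Longrightarrow> map_poly of_int (F d) = ?C d"
      by metis
    define Q where "Q = prod F ?D"
    have hom: "map_poly (of_int :: int \<Rightarrow> complex) (prod F A) = (\<Prod>d\<in>A. map_poly of_int (F d))"
      if "finite A" for A
      using that
    proof induction
      case (insert x A)
      show ?case
        using insert by (simp add: of_int_poly_mult)
    qed simp
    have Q: "map_poly of_int Q = (\<Prod>d\<in>?D. ?C d)"
      unfolding Q_def hom[OF D(1)] by (rule prod.cong[OF refl F])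
    let ?Q = "map_poly (of_int :: int \<Rightarrow> complex) Q"
    have "monom 1 n - 1 = (\<Prod>z\<in>(\<Union>d\<in>{d. d dvd n}. primitive_roots d). [:- z, 1:])"
      using less.prems by (simp add: roots_unity_eq_Union_primitive_roots flip: prod_roots_unity)
    also have "\<dots> = (\<Prod>d | d dvd n. ?C d)"
    proof (rule prod.UNION_disjoint)
      show "finite {d. d dvd n}" using less.prems by simp
      show "\<forall>d\<in>{d. d dvd n}. finite (primitive_roots d)"
        using less.prems dvd_pos_nat finite_primitive_roots by blast
      show "\<forall>d\<in>{d. d dvd n}. \<forall>e\<in>{d. d dvd n}. d \<noteq> e \<longrightarrow>
              primitive_roots d \<inter> primitive_roots e = {}"
        using dvd_pos_nat[OF less.prems] by (simp add: primitive_roots_disjoint)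
    qed
    also have "\<dots> = ?Q * ?C n"
      unfolding Q D(2) using D(1) by (subst prod.insert) (auto simp: mult.commute)
    finally have fact: "monom 1 n - 1 = ?Q * ?C n" .
    have degQ: "degree ?Q = degree Q" by (simp add: degree_map_poly)
    have "lead_coeff ?Q = 1" unfolding Q by (simp add: lead_coeff_prod)
    hence "of_int (lead_coeff Q) = (1 :: complex)" by (simp add: degQ coeff_map_poly)
    hence lead: "lead_coeff Q = 1" by (metis of_int_eq_1_iff)
    hence nz: "Q \<noteq> 0" by auto
    obtain q r where qr: "pseudo_divmod (monom 1 n - 1) Q = (q, r)" by fastforce
    have eq: "monom 1 n - 1 = Q * q + r" and r: "r = 0 \<or> degree r < degree Q"
      using pseudo_divmod[OF nz qr] by (simp_all add: lead)
    let ?q = "map_poly (of_int :: int \<Rightarrow> complex) q"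
    let ?r = "map_poly (of_int :: int \<Rightarrow> complex) r"
    have "monom 1 n - 1 = map_poly (of_int :: int \<Rightarrow> complex) (monom 1 n - 1)"
      by (rule poly_eqI) (simp add: coeff_map_poly coeff_1)
    hence "?Q * ?C n = ?Q * ?q + ?r"
      unfolding eq fact by (simp add: of_int_poly_add of_int_poly_mult)
    hence req: "?r = ?Q * (?C n - ?q)" by (simp add: algebra_simps)
    have "?C n - ?q = 0"
    proof (rule ccontr)
      assume *: "?C n - ?q \<noteq> 0"
      have nz': "?Q \<noteq> 0" using \<open>lead_coeff ?Q = 1\<close> by auto
      have "?r \<noteq> 0" unfolding req using * nz' by simp
      hence "r \<noteq> 0" by auto
      have "degree ?r = degree ?Q + degree (?C n - ?q)"
        unfolding req using * nz' by (rule_tac degree_mult_eq) auto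
      moreover have "degree ?r = degree r" by (simp add: degree_map_poly)
      ultimately show False using r degQ \<open>r \<noteq> 0\<close> by simp
    qed
    thus ?case by (metis eq_iff_diff_eq_0)
  qed
  with inj show ?thesis by metis
qed

lemma of_int_cyclotomic:
  assumes "n > 0"
  shows "map_poly of_int (cyclotomic n) = (\<Prod>z\<in>primitive_roots n. [:- z, 1:])"
  unfolding cyclotomic_def by (rule theI'[OF ex1_int_poly_primitive_roots[OF assms]])


section \<open>Rational functions and congruences\<close>

text \<open>The field of rational functions in \<open>q\<close> over the rationals is represented by
  \<open>int poly fract\<close>; \<open>qvar\<close> is the indeterminate \<open>q\<close>.\<close>

definition qvar :: "int poly fract" where
  "qvar = to_fract [:0, 1:]"

definition ratfun_cong :: "int poly fract \<Rightarrow> int poly fract \<Rightarrow> int poly \<Rightarrow> bool" where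
  "ratfun_cong A B P \<longleftrightarrow>
     (\<exists>A1 A2. A2 \<noteq> 0 \<and> A - B = Fract A1 A2 \<and> P dvd A1 \<and> coprime A2 P)"


section \<open>\<open>q\<close>-binomial and \<open>q\<close>-trinomial coefficients\<close>

definition qbinom :: "'a::field \<Rightarrow> int \<Rightarrow> int \<Rightarrow> 'a" where
  "qbinom q n k =
     (if 0 \<le> k \<and> k \<le> n
      then (\<Prod>i<nat k. 1 - q ^ (nat n - i)) / (\<Prod>i=1..nat k. 1 - q ^ i)
      else 0)"

definition T0 :: "int \<Rightarrow> int \<Rightarrow> 'a::field \<Rightarrow> 'a" where
  "T0 N M q =
     (\<Sum>k=0..N. (-1) ^ nat k * qbinom (q ^ 2) N k * qbinom q (2 * N - 2 * k) (N - M - k))"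

definition calA :: "nat \<Rightarrow> 'a::field \<Rightarrow> 'a" where
  "calA n q =
     (let r = n div 3 in
      if n mod 3 = 0 then (-1) ^ r * (1 + q ^ r) * q ^ (r * (3 * r - 1) div 2)
      else if n mod 3 = 1 then (-1) ^ r * q ^ (r * (3 * r + 1) div 2)
      else (-1) ^ (r + 1) * q ^ ((r + 1) * (3 * r + 2) div 2))"

end

theory Submission
  imports Defs
begin

text \<open>
  The difference \<open>D\<close> of both sides is an integer polynomial, and \<open>\<Phi>\<^sub>n\<^sup>2\<close> divides it iff every primitive
  \<open>n\<close>-th root of unity \<open>\<zeta>\<close> is a double root, that is, iff \<open>D(x) / (1 - x\<^sup>n) \<rightarrow> 0\<close> as \<open>x \<rightarrow> \<zeta>\<close>.
  In \<open>T\<^sub>0(mn, (m-1)n, q)\<close> only the summands \<open>k = 0, ..., n\<close> survive. Those with \<open>k = 0\<close> and \<open>k = n\<close>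
  are expanded to first order in \<open>1 - x\<^sup>n\<close>. Each of the others vanishes at \<open>\<zeta>\<close>, and its quotient by
  \<open>1 - x\<^sup>n\<close> tends, with \<open>j = n - k\<close> and up to a common factor, to the \<open>j\<close>-th summand at \<open>\<zeta>\<close> of
  \[ \frac{\mathcal{A}_n(q) - 1}{1 - q^n}
     = \sum_{j \ge 1} (-1)^j q^{j(j-1)/2} \frac{1}{1 - q^{n-j}} {n-j \brack j}. \]
  This identity is \<open>\<A>\<^sub>n = S\<^sub>n - q\<^sup>n\<^sup>-\<^sup>1 S\<^sub>n\<^sub>-\<^sub>2\<close> for Schur's sums \<open>S\<^sub>n = \<Sum>\<^sub>j (-1)\<^sup>j q\<^bsup>j(j-1)/2\<^esup> [n-j, j]\<close>,
  which satisfy \<open>S\<^sub>n = - q\<^sup>n\<^sup>-\<^sup>2 S\<^sub>n\<^sub>-\<^sub>3\<close>.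
\<close>

section \<open>Gaussian binomial coefficients in commutative rings\<close>

text \<open>The q-Pascal recursion needs no division, so the coefficient makes sense over
  \<open>int poly\<close> and at roots of unity, where the quotient of products can become
  0/0.\<close>

fun gauss_binom :: "'a::comm_ring_1 \<Rightarrow> nat \<Rightarrow> nat \<Rightarrow> 'a" where
  "gauss_binom q n 0 = 1"
| "gauss_binom q 0 (Suc k) = 0"
| "gauss_binom q (Suc n) (Suc k) = gauss_binom q n k + q ^ Suc k * gauss_binom q n (Suc k)"

lemma gauss_binom_eq_0: "n < k \<Longrightarrow> gauss_binom q n k = 0"
  by (induction q n k rule: gauss_binom.induct) auto

lemma gauss_binom_self [simp]: "gauss_binom q n n = 1"
  by (induction n) (auto simp: gauss_binom_eq_0)

text \<open>The mirror image of the defining q-Pascal rule. Both terms of that rule are expanded by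
  the induction hypothesis and regrouped. The truncated exponent \<open>n - k\<close> does no harm:
  for \<open>k > n\<close> it multiplies zero.\<close>

lemma gauss_binom_Suc_Suc':
  "gauss_binom q (Suc n) (Suc k) = q ^ (n - k) * gauss_binom q n k + gauss_binom q n (Suc k)"
proof (induction n arbitrary: k)
  case 0
  then show ?case by (cases k) auto
next
  case (Suc n)
  show ?case
  proof (cases k)
    case 0
    show ?thesis
      using Suc[of 0] by (simp add: 0 algebra_simps)
  next
    case (Suc k')
    let ?G = "gauss_binom q"
    have "?G (Suc (Suc n)) (Suc k) = ?G (Suc n) (Suc k') + q ^ Suc k * ?G (Suc n) (Suc k)"
      by (simp add: Suc)
    also have "\<dots> = (q ^ (n - k') * ?G n k' + ?G n k)
                     + q ^ Suc k * (q ^ (n - k) * ?G n k + ?G n (Suc k))"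
      by (simp only: Suc.IH Suc)
    also have "q ^ Suc k * (q ^ (n - k) * ?G n k) = q ^ (n - k') * (q ^ k * ?G n k)"
    proof (cases "k \<le> n")
      case True
      then have "Suc k + (n - k) = (n - k') + k" using Suc by simp
      then have "q ^ Suc k * q ^ (n - k) = q ^ (n - k') * q ^ k"
        by (simp only: flip: power_add)
      then show ?thesis by (simp only: mult.assoc[symmetric])
    qed (simp add: gauss_binom_eq_0)
    then have "(q ^ (n - k') * ?G n k' + ?G n k)
                     + q ^ Suc k * (q ^ (n - k) * ?G n k + ?G n (Suc k))
      = q ^ (n - k') * (?G n k' + q ^ k * ?G n k) + (?G n k + q ^ Suc k * ?G n (Suc k))"
      by (simp add: algebra_simps)
    also have "\<dots> = q ^ (Suc n - k) * ?G (Suc n) k + ?G (Suc n) (Suc k)"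
      by (simp add: Suc)
    finally show ?thesis .
  qed
qed

text \<open>One copy of the coefficient is expanded by each of the two q-Pascal rules, and the
  \<open>Suc k\<close> terms cancel. This isolates the factor \<open>1 - q ^ Suc n\<close>, the
  source of every zero at a root of unity below.\<close>

lemma gauss_binom_absorb:
  "gauss_binom q (Suc n) (Suc k) * (1 - q ^ Suc k) = (1 - q ^ Suc n) * gauss_binom q n k"
proof (cases "k \<le> n")
  case True
  let ?G = "gauss_binom q"
  have "?G (Suc n) (Suc k) * (1 - q ^ Suc k)
      = ?G (Suc n) (Suc k) - q ^ Suc k * ?G (Suc n) (Suc k)"
    by (simp add: algebra_simps del: gauss_binom.simps)
  also have "\<dots> = ?G n k + q ^ Suc k * ?G n (Suc k)
      - q ^ Suc k * (q ^ (n - k) * ?G n k + ?G n (Suc k))"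
    by (subst (2) gauss_binom_Suc_Suc') simp
  also have "\<dots> = (1 - q ^ (Suc k + (n - k))) * ?G n k"
    by (simp add: algebra_simps power_add)
  finally show ?thesis using True by simp
qed (simp add: gauss_binom_eq_0)

text \<open>The product formula with denominators cleared. It survives \<open>k > n\<close>, where
  the factor with \<open>i = n\<close> on the right is zero.\<close>

lemma gauss_binom_prod:
  "gauss_binom q n k * (\<Prod>i=1..k. 1 - q ^ i) = (\<Prod>i<k. 1 - q ^ (n - i))"
proof (induction k arbitrary: n)
  case (Suc k)
  show ?case
  proof (cases n)
    case 0
    then show ?thesis by (simp add: prod.lessThan_Suc_shift)
  next
    case (Suc n')
    have "gauss_binom q n (Suc k) * (\<Prod>i=1..Suc k. 1 - q ^ i)
        = (gauss_binom q (Suc n') (Suc k) * (1 - q ^ Suc k)) * (\<Prod>i=1..k. 1 - q ^ i)"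
      by (simp add: Suc mult_ac)
    also have "\<dots> = (1 - q ^ Suc n') * (gauss_binom q n' k * (\<Prod>i=1..k. 1 - q ^ i))"
      by (simp only: gauss_binom_absorb mult.assoc)
    also have "\<dots> = (\<Prod>i<Suc k. 1 - q ^ (n - i))"
      unfolding Suc.IH by (subst prod.lessThan_Suc_shift) (simp add: Suc)
    finally show ?thesis .
  qed
qed simp

lemma gauss_binom_trinomial_revision:
  "gauss_binom q N (l + s) * gauss_binom q (l + s) s = gauss_binom q N l * gauss_binom q (N - l) s"
proof (induction N arbitrary: l s)
  case 0
  then show ?case by (cases l; cases s) auto
next
  case (Suc N)
  show ?case
  proof (cases l; cases s)
    fix l' s'
    assume l: "l = Suc l'" and s: "s = Suc s'"
    let ?G = "gauss_binom q"
    let ?t = "l' + s'"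
    have IH1: "?G N (Suc ?t) * ?G (Suc ?t) s' = ?G N (Suc l') * ?G (N - Suc l') s'"
      using Suc[of "Suc l'" s'] by simp
    have IH2: "?G N (Suc ?t) * ?G (Suc ?t) (Suc s') = ?G N l' * ?G (N - l') (Suc s')"
      using Suc[of l' "Suc s'"] by simp
    have IH3: "?G N (Suc (Suc ?t)) * ?G (Suc (Suc ?t)) (Suc s')
        = ?G N (Suc l') * ?G (N - Suc l') (Suc s')"
      using Suc[of "Suc l'" "Suc s'"] by simp
    have "?G (Suc N) (l + s) * ?G (l + s) s
       = ?G N (Suc ?t) * ?G (Suc (Suc ?t)) (Suc s')
       + q ^ (Suc (Suc ?t)) * (?G N (Suc (Suc ?t)) * ?G (Suc (Suc ?t)) (Suc s'))"
      by (simp add: l s algebra_simps del: gauss_binom.simps(3))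
         (simp add: algebra_simps)
    also have "?G (Suc (Suc ?t)) (Suc s') = q ^ Suc l' * ?G (Suc ?t) s' + ?G (Suc ?t) (Suc s')"
      by (subst gauss_binom_Suc_Suc') (simp add: Suc_diff_le)
    also have "?G N (Suc ?t) * (q ^ Suc l' * ?G (Suc ?t) s' + ?G (Suc ?t) (Suc s'))
      = q ^ Suc l' * (?G N (Suc ?t) * ?G (Suc ?t) s') + ?G N (Suc ?t) * ?G (Suc ?t) (Suc s')"
      by (simp only: algebra_simps)
    finally have 1: "?G (Suc N) (l + s) * ?G (l + s) s
       = q ^ Suc l' * (?G N (Suc l') * ?G (N - Suc l') s') + ?G N l' * ?G (N - l') (Suc s')
       + q ^ (Suc (Suc ?t)) * (?G N (Suc l') * ?G (N - Suc l') (Suc s'))"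
      using IH1 IH2 IH3 \<open>?G (Suc (Suc ?t)) (Suc s') = _\<close> by metis
    have "?G (N - l') (Suc s') = ?G (N - Suc l') s' + q ^ Suc s' * ?G (N - Suc l') (Suc s')"
      if "l' < N"
    proof -
      have "N - l' = Suc (N - Suc l')" using that by simp
      then show ?thesis by simp
    qed
    \<comment> \<open>For \<open>l' \<ge> N\<close> the factor \<open>?G N (Suc l')\<close> is zero,
      so the expansion holds despite the truncated subtraction.\<close>
    then have 2: "?G N (Suc l') * ?G (N - l') (Suc s')
      = ?G N (Suc l') * (?G (N - Suc l') s' + q ^ Suc s' * ?G (N - Suc l') (Suc s'))"
      by (cases "l' < N") (simp_all add: gauss_binom_eq_0)
    have "?G (Suc N) l * ?G (Suc N - l) s
      = ?G N l' * ?G (N - l') (Suc s') + q ^ Suc l' * (?G N (Suc l') * ?G (N - l') (Suc s'))"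
      by (simp add: l s algebra_simps)
    also have "\<dots> = ?G (Suc N) (l + s) * ?G (l + s) s"
      unfolding 1 2 by (simp add: algebra_simps power_add)
    finally show ?thesis by simp
  qed auto
qed

section \<open>The finite pentagonal number identity\<close>

text \<open>The body of \<open>calA\<close> over a commutative ring, so that it can be evaluated in \<open>int poly\<close>, which is not a field.\<close>

definition calA_ring :: "nat \<Rightarrow> 'a::comm_ring_1 \<Rightarrow> 'a" where
  "calA_ring n q =
     (let r = n div 3 in
      if n mod 3 = 0 then (-1) ^ r * (1 + q ^ r) * q ^ (r * (3 * r - 1) div 2)
      else if n mod 3 = 1 then (-1) ^ r * q ^ (r * (3 * r + 1) div 2)
      else (-1) ^ (r + 1) * q ^ ((r + 1) * (3 * r + 2) div 2))"

section \<open>Schur's sums and their recurrences\<close>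

definition schur_sum :: "'a::comm_ring_1 \<Rightarrow> nat \<Rightarrow> 'a" where
  "schur_sum q n = (\<Sum>k\<le>n. (-1) ^ k * q ^ (k choose 2) * gauss_binom q (n - k) k)"

text \<open>A companion of \<open>schur_sum\<close> with exponent \<open>k * (k + 1) / 2\<close>.
  Each of the two q-Pascal rules yields one relation between the two families, and together they
  eliminate the companion.\<close>

definition schur_sum_shifted :: "'a::comm_ring_1 \<Rightarrow> nat \<Rightarrow> 'a" where
  "schur_sum_shifted q n = (\<Sum>k\<le>n. (-1) ^ k * q ^ (Suc k choose 2) * gauss_binom q (n - k) k)"

lemma Suc_choose_2: "Suc k choose 2 = k + (k choose 2)"
  by (simp add: numeral_2_eq_2)

lemma zero_choose_2 [simp]: "0 choose 2 = 0"
  by (simp add: binomial_eq_0)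

lemma Suc_0_choose_2 [simp]: "Suc 0 choose 2 = 0"
  by (simp add: binomial_eq_0)

lemma schur_sum_Suc:
  "schur_sum q (Suc n) = 1 - (\<Sum>j\<le>n. (-1) ^ j * q ^ (Suc j choose 2) * gauss_binom q (n - j) (Suc j))"
  unfolding schur_sum_def by (subst sum.atMost_Suc_shift) (simp add: sum_negf)

lemma schur_sum_shifted_Suc:
  "schur_sum_shifted q (Suc n)
     = 1 - (\<Sum>j\<le>n. (-1) ^ j * q ^ (Suc (Suc j) choose 2) * gauss_binom q (n - j) (Suc j))"
  unfolding schur_sum_shifted_def by (subst sum.atMost_Suc_shift) (simp add: sum_negf)

lemma schur_sum_rec:
  "schur_sum q (Suc (Suc n)) = schur_sum_shifted q (Suc n) - schur_sum_shifted q n"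
proof -
  let ?G = "gauss_binom q"
  \<comment> \<open>The summand for \<open>j = Suc n\<close> is zero; in all others the upper index
    is a successor, ready for the q-Pascal rule.\<close>
  have "(\<Sum>j\<le>Suc n. (-1) ^ j * q ^ (Suc j choose 2) * ?G (Suc n - j) (Suc j))
      = (\<Sum>j\<le>n. (-1) ^ j * q ^ (Suc j choose 2) * ?G (Suc (n - j)) (Suc j))"
    by (simp add: Suc_diff_le)
  also have "\<dots> = (\<Sum>j\<le>n. (-1) ^ j * q ^ (Suc j choose 2) * ?G (n - j) j
      + (-1) ^ j * q ^ (Suc (Suc j) choose 2) * ?G (n - j) (Suc j))"
    by (intro sum.cong refl) (simp add: Suc_choose_2 algebra_simps power_add)
  finally show ?thesis
    unfolding schur_sum_Suc schur_sum_shifted_Suc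
    by (simp add: sum.distrib schur_sum_shifted_def)
qed

lemma schur_sum_shifted_rec:
  "schur_sum_shifted q (Suc (Suc n)) = schur_sum_shifted q (Suc n) - q ^ Suc n * schur_sum q n"
proof -
  let ?G = "gauss_binom q"
  have "(\<Sum>j\<le>Suc n. (-1) ^ j * q ^ (Suc (Suc j) choose 2) * ?G (Suc n - j) (Suc j))
      = (\<Sum>j\<le>n. (-1) ^ j * q ^ (Suc (Suc j) choose 2) * ?G (Suc (n - j)) (Suc j))"
    by (simp add: Suc_diff_le)
  also have "\<dots> = (\<Sum>j\<le>n. (-1) ^ j * q ^ (Suc (Suc j) choose 2) * ?G (n - j) (Suc j)
      + q ^ Suc n * ((-1) ^ j * q ^ (j choose 2) * ?G (n - j) j))"
  proof (intro sum.cong refl)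
    fix j
    \<comment> \<open>The exponents agree only when \<open>2 * j \<le> n\<close>; otherwise
      \<open>?G (n - j) j\<close> is zero.\<close>
    have "q ^ (Suc (Suc j) choose 2) * (q ^ (n - j - j) * ?G (n - j) j)
        = q ^ Suc n * (q ^ (j choose 2) * ?G (n - j) j)"
    proof (cases "2 * j \<le> n")
      case True
      then have "(Suc (Suc j) choose 2) + (n - j - j) = Suc n + (j choose 2)"
        by (simp add: Suc_choose_2)
      then show ?thesis
        by (simp only: mult.assoc[symmetric] flip: power_add)
    qed (simp add: gauss_binom_eq_0)
    then show "(-1) ^ j * q ^ (Suc (Suc j) choose 2) * ?G (Suc (n - j)) (Suc j)
      = (-1) ^ j * q ^ (Suc (Suc j) choose 2) * ?G (n - j) (Suc j)
      + q ^ Suc n * ((-1) ^ j * q ^ (j choose 2) * ?G (n - j) j)"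
      unfolding gauss_binom_Suc_Suc' by (simp add: algebra_simps)
  qed
  finally show ?thesis
    unfolding schur_sum_shifted_Suc
    by (simp add: sum.distrib sum_distrib_left schur_sum_def)
qed

text \<open>\<open>schur_sum_rec\<close> makes the left side a difference of consecutive shifted
  sums, and \<open>schur_sum_shifted_rec\<close> evaluates that difference.\<close>

lemma schur_sum_rec3: "schur_sum q (n + 3) = - (q ^ (n + 1)) * schur_sum q n"
  using schur_sum_rec[of q "Suc n"] schur_sum_shifted_rec[of q n]
  by (simp add: eval_nat_numeral)

text \<open>The recurrence in steps of three, started from the values 1, 1, 0. The exponents
  accumulate to the generalized pentagonal numbers.\<close>

lemma schur_sum_closed:
  "schur_sum q (3 * r) = (-1) ^ r * q ^ (r * (3 * r - 1) div 2)"
  "schur_sum q (3 * r + 1) = (-1) ^ r * q ^ (r * (3 * r + 1) div 2)"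
  "schur_sum q (3 * r + 2) = 0"
proof (induction r)
  case 0
  {
    case 1
    then show ?case by (simp add: schur_sum_def)
  next
    case 2
    then show ?case by (simp add: schur_sum_def)
  next
    case 3
    then show ?case by (simp add: schur_sum_def eval_nat_numeral)
  }
next
  case (Suc r)
  {
    case 1
    have "Suc r * (3 * Suc r - 1) = 2 * (3 * r + 1) + r * (3 * r - 1)"
      by (cases r) (simp_all add: algebra_simps)
    then have e: "Suc r * (3 * Suc r - 1) div 2 = (3 * r + 1) + r * (3 * r - 1) div 2"
      by (metis div_mult_self4 zero_neq_numeral mult.commute add.commute)
    have "schur_sum q (3 * Suc r) = - (q ^ (3 * r + 1)) * schur_sum q (3 * r)"
      using schur_sum_rec3[of q "3 * r"] by (simp add: add.commute)
    then show ?case unfolding e Suc.IH(1) power_add by simp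
  next
    case 2
    have "Suc r * (3 * Suc r + 1) = 2 * (3 * r + 2) + r * (3 * r + 1)"
      by (simp add: algebra_simps)
    then have e: "Suc r * (3 * Suc r + 1) div 2 = (3 * r + 2) + r * (3 * r + 1) div 2"
      by (metis div_mult_self4 zero_neq_numeral mult.commute add.commute)
    have "schur_sum q (3 * Suc r + 1) = - (q ^ (3 * r + 2)) * schur_sum q (3 * r + 1)"
      using schur_sum_rec3[of q "3 * r + 1"] by (simp add: add.commute)
    then show ?case unfolding e Suc.IH(2) power_add by simp
  next
    case 3
    show ?case
      using schur_sum_rec3[of q "3 * r + 2"] Suc.IH(3) by (simp add: add.commute)
  }
qed

text \<open>If 3 divides \<open>n + 2\<close>, both Schur sums contribute and produce the factor
  \<open>1 + q ^ r\<close>. In the other two residue classes one of them is zero.\<close>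

lemma calA_ring_eq_schur_sum:
  "calA_ring (n + 2) q = schur_sum q (n + 2) - q ^ (n + 1) * schur_sum q n"
proof -
  consider r where "n + 2 = 3 * Suc r" | r where "n + 2 = 3 * Suc r + 1" | r where "n + 2 = 3 * r + 2"
  proof -
    have "n mod 3 = 0 \<or> n mod 3 = 1 \<or> n mod 3 = 2" by auto
    moreover have "n = 3 * (n div 3) + n mod 3" by simp
    ultimately have "n + 2 = 3 * Suc (n div 3) \<or> n + 2 = 3 * Suc (n div 3) + 1 \<or> n + 2 = 3 * (n div 3) + 2"
      by arith
    then show ?thesis
      using that by blast
  qed
  then show ?thesis
  proof cases
    case 1
    then have n: "n = 3 * r + 1" by simp
    have "2 * (3 * r + 2) + r * (3 * r + 1) = 2 * Suc r + Suc r * (3 * Suc r - 1)"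
      by (simp add: algebra_simps)
    then have "(3 * r + 2) + r * (3 * r + 1) div 2 = Suc r + Suc r * (3 * Suc r - 1) div 2"
      by (metis div_mult_self4 zero_neq_numeral mult.commute add.commute)
    then have e: "q ^ (3 * r + 2) * q ^ (r * (3 * r + 1) div 2)
        = q ^ Suc r * q ^ (Suc r * (3 * Suc r - 1) div 2)"
      by (simp only: flip: power_add)
    have "calA_ring (n + 2) q = (-1) ^ Suc r * (1 + q ^ Suc r) * q ^ (Suc r * (3 * Suc r - 1) div 2)"
      unfolding 1 calA_ring_def by simp
    also have "\<dots> = (-1) ^ Suc r * q ^ (Suc r * (3 * Suc r - 1) div 2)
         - q ^ (3 * r + 2) * ((-1) ^ r * q ^ (r * (3 * r + 1) div 2))"
      unfolding mult.left_commute[of _ "(-1) ^ r"] e by (simp add: algebra_simps)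
    also have "\<dots> = schur_sum q (n + 2) - q ^ (n + 1) * schur_sum q n"
      unfolding 1 unfolding n schur_sum_closed by simp
    finally show ?thesis .
  next
    case 2
    then have n: "n = 3 * r + 2" by simp
    have "(3 * Suc r + 1) div 3 = Suc r" "(3 * Suc r + 1) mod 3 = 1"
      by presburger+
    then show ?thesis
      unfolding 2 unfolding n schur_sum_closed calA_ring_def Let_def by simp
  next
    case 3
    then have n: "n = 3 * r" by simp
    have "2 * (3 * r + 1) + r * (3 * r - 1) = (r + 1) * (3 * r + 2)"
      by (cases r) (simp_all add: algebra_simps)
    then have e: "(r + 1) * (3 * r + 2) div 2 = (3 * r + 1) + r * (3 * r - 1) div 2"
      by (metis div_mult_self4 zero_neq_numeral mult.commute add.commute)
    have "(3 * r + 2) div 3 = r" "(3 * r + 2) mod 3 = 2"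
      by presburger+
    then have "calA_ring (n + 2) q = (-1) ^ (r + 1) * q ^ ((r + 1) * (3 * r + 2) div 2)"
      unfolding 3 calA_ring_def Let_def by simp
    also have "\<dots> = - (q ^ (3 * r + 1) * ((-1) ^ r * q ^ (r * (3 * r - 1) div 2)))"
      unfolding e power_add by simp
    finally show ?thesis
      unfolding 3 unfolding n schur_sum_closed by simp
  qed
qed

text \<open>Multiplying by \<open>1 - q ^ n\<close> turns the \<open>j\<close>-th quotient into
  \<open>gauss_binom q (n - j) j + q ^ (n - j) * gauss_binom q (n - j - 1) (j - 1)\<close>. The
  first parts add up to \<open>schur_sum q n - 1\<close>, the second to
  \<open>- q ^ (n - 1) * schur_sum q (n - 2)\<close>.\<close>

lemma calA_ring_expansion:
  fixes q :: "'a::field"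
  assumes "n > 0" and nz: "\<And>i. 0 < i \<Longrightarrow> i < n \<Longrightarrow> q ^ i \<noteq> 1"
  shows "calA_ring n q - 1 =
    (1 - q ^ n) * (\<Sum>j=1..<n. (-1) ^ j * q ^ (j choose 2) * gauss_binom q (n - j) j / (1 - q ^ (n - j)))"
proof (cases "n = 1")
  case True
  then show ?thesis by (simp add: calA_ring_def)
next
  case False
  then obtain p where p: "n = Suc (Suc p)"
    using assms(1) by (metis One_nat_def not0_implies_Suc less_not_refl)
  let ?G = "gauss_binom q"
  have "(1 - q ^ n) * (\<Sum>j=1..<n. (-1) ^ j * q ^ (j choose 2) * ?G (n - j) j / (1 - q ^ (n - j)))
    = (1 - q ^ n) * (\<Sum>j<Suc p. (-1) ^ Suc j * q ^ (Suc j choose 2) * ?G (n - Suc j) (Suc j)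
          / (1 - q ^ (n - Suc j)))"
    using sum.shift_bounds_Suc_ivl[of "\<lambda>j. (-1) ^ j * q ^ (j choose 2) * ?G (n - j) j / (1 - q ^ (n - j))" 0 "Suc p"]
    by (simp only: p One_nat_def atLeast0LessThan)
  also have "\<dots> = (\<Sum>j\<le>p. (-1) ^ Suc j * q ^ (Suc j choose 2) * ?G (Suc p - j) (Suc j)
      + - (q ^ Suc p) * ((-1) ^ j * q ^ (j choose 2) * ?G (p - j) j))"
    unfolding lessThan_Suc_atMost sum_distrib_left
  proof (intro sum.cong refl)
    fix j assume "j \<in> {..p}"
    then have j: "j \<le> p" by simp
    have d: "1 - q ^ (Suc (p - j)) \<noteq> 0"
      using nz[of "Suc (p - j)"] j p by auto
    have nj: "n - Suc j = Suc (p - j)" "Suc p - j = Suc (p - j)" using j p by auto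
    have qn: "q ^ n = q ^ Suc (p - j) * q ^ Suc j"
      unfolding power_add[symmetric] using j p by simp
    have abs: "?G (Suc (p - j)) (Suc j) * (1 - q ^ Suc j) = (1 - q ^ Suc (p - j)) * ?G (p - j) j"
      by (rule gauss_binom_absorb)
    \<comment> \<open>With \<open>a = Suc (p - j)\<close>, split \<open>1 - q ^ n\<close> as
      \<open>(1 - q ^ a) + q ^ a * (1 - q ^ Suc j)\<close>; absorption makes the second part
      divisible by \<open>1 - q ^ a\<close> too.\<close>
    have "(1 - q ^ n) * ?G (Suc (p - j)) (Suc j)
       = (1 - q ^ Suc (p - j)) * ?G (Suc (p - j)) (Suc j)
         + q ^ Suc (p - j) * (?G (Suc (p - j)) (Suc j) * (1 - q ^ Suc j))"
      unfolding qn by (simp add: algebra_simps del: gauss_binom.simps power_Suc)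
    also have "\<dots> = (1 - q ^ Suc (p - j)) * (?G (Suc (p - j)) (Suc j) + q ^ Suc (p - j) * ?G (p - j) j)"
      unfolding abs by (simp add: algebra_simps del: gauss_binom.simps power_Suc)
    finally have 1: "(1 - q ^ n) * (?G (Suc (p - j)) (Suc j) / (1 - q ^ Suc (p - j)))
       = ?G (Suc (p - j)) (Suc j) + q ^ Suc (p - j) * ?G (p - j) j"
      by (simp only: times_divide_eq_right nonzero_mult_div_cancel_left[OF d])
    have 2: "q ^ (Suc j choose 2) * q ^ Suc (p - j) = q ^ Suc p * q ^ (j choose 2)"
      unfolding power_add[symmetric] using j by (simp add: Suc_choose_2 add.commute)
    have "(1 - q ^ n) * ((-1) ^ Suc j * q ^ (Suc j choose 2) * ?G (n - Suc j) (Suc j) / (1 - q ^ (n - Suc j)))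
      = (-1) ^ Suc j * q ^ (Suc j choose 2) * ((1 - q ^ n) * (?G (Suc (p - j)) (Suc j) / (1 - q ^ Suc (p - j))))"
      unfolding nj by (simp only: times_divide_eq_right mult_ac)
    also have "\<dots> = (-1) ^ Suc j * q ^ (Suc j choose 2) * ?G (Suc (p - j)) (Suc j)
       + (-1) ^ Suc j * (q ^ (Suc j choose 2) * q ^ Suc (p - j)) * ?G (p - j) j"
      unfolding 1 by (simp only: algebra_simps)
    also have "\<dots> = (-1) ^ Suc j * q ^ (Suc j choose 2) * ?G (Suc p - j) (Suc j)
      + - (q ^ Suc p) * ((-1) ^ j * q ^ (j choose 2) * ?G (p - j) j)"
      unfolding 2 nj by simp
    finally show "(1 - q ^ n) * ((-1) ^ Suc j * q ^ (Suc j choose 2) * ?G (n - Suc j) (Suc j) / (1 - q ^ (n - Suc j)))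
       = (-1) ^ Suc j * q ^ (Suc j choose 2) * ?G (Suc p - j) (Suc j)
      + - (q ^ Suc p) * ((-1) ^ j * q ^ (j choose 2) * ?G (p - j) j)" .
  qed
  also have "\<dots> = schur_sum q n - 1 - q ^ Suc p * schur_sum q p"
    unfolding p schur_sum_Suc
    by (simp add: sum.distrib sum_distrib_left schur_sum_def sum_negf sum_subtractf mult_ac del: gauss_binom.simps(3))
  also have "\<dots> = calA_ring n q - 1"
    using calA_ring_eq_schur_sum[of p q] by (simp add: p)
  finally show ?thesis ..
qed

section \<open>Gaussian binomials near a root of unity\<close>

lemma tendsto_gauss_binom:
  fixes f :: "'b \<Rightarrow> 'a::{real_normed_algebra_1,comm_ring_1}"
  assumes "(f \<longlongrightarrow> c) F"
  shows "((\<lambda>x. gauss_binom (f x) n k) \<longlongrightarrow> gauss_binom c n k) F"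
  using assms
proof (induction c n k rule: gauss_binom.induct)
  case (3 c n k)
  then show ?case
    by (auto intro!: tendsto_intros)
qed auto

lemma tendsto_geometric_quotient:
  fixes v :: "'b \<Rightarrow> 'a::real_normed_field"
  assumes "(v \<longlongrightarrow> 1) F" "\<forall>\<^sub>F x in F. v x \<noteq> 1"
  shows "((\<lambda>x. (1 - v x ^ M) / (1 - v x)) \<longlongrightarrow> of_nat M) F"
proof -
  have "((\<lambda>x. \<Sum>i<M. v x ^ i) \<longlongrightarrow> (\<Sum>i<M. 1 ^ i)) F"
    by (intro tendsto_intros assms)
  then have "((\<lambda>x. \<Sum>i<M. v x ^ i) \<longlongrightarrow> of_nat M) F"
    by simp
  then show ?thesis
    by (rule Lim_transform_eventually)
       (use assms(2) in eventually_elim, simp add: one_diff_power_eq)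
qed

lemma primitive_roots_nonzero: "\<eta> \<in> primitive_roots d \<Longrightarrow> d > 0 \<Longrightarrow> \<eta> \<noteq> 0"
  by (auto simp: primitive_roots_def power_0_left)

lemma primitive_roots_power_mult:
  "\<eta> \<in> primitive_roots d \<Longrightarrow> \<eta> ^ (M * d) = 1"
  "\<eta> \<in> primitive_roots d \<Longrightarrow> \<eta> ^ (d * M) = 1"
  by (simp_all add: primitive_roots_def power_mult power_mult[of _ _ d] mult.commute[of M])

text \<open>By absorption \<open>gauss_binom \<eta> (M * d) (Suc k)\<close> is zero for
  \<open>Suc k < d\<close>, so the q-Pascal rule gives consecutive values in row
  \<open>M * d - 1\<close> the ratio \<open>- 1 / \<eta> ^ Suc k\<close>.\<close>

lemma gauss_binom_root_pred:
  assumes \<eta>: "\<eta> \<in> primitive_roots d" and "M > 0" "k < d"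
  shows "gauss_binom \<eta> (M * d - 1) k = (-1) ^ k / \<eta> ^ (Suc k choose 2)"
  using \<open>k < d\<close>
proof (induction k)
  case (Suc k)
  obtain N where N: "M * d = Suc N"
    using assms by (cases "M * d") auto
  have "\<eta> ^ Suc N = 1"
    using primitive_roots_power_mult(1)[OF \<eta>, of M] N by simp
  then have "gauss_binom \<eta> (Suc N) (Suc k) * (1 - \<eta> ^ Suc k) = 0"
    by (simp only: gauss_binom_absorb) simp
  moreover have "1 - \<eta> ^ Suc k \<noteq> 0"
    using \<eta> Suc.prems by (auto simp: primitive_roots_def)
  ultimately have "gauss_binom \<eta> (Suc N) (Suc k) = 0"
    by simp
  then have "\<eta> ^ Suc k * gauss_binom \<eta> N (Suc k) = - gauss_binom \<eta> N k"
    by (simp add: add_eq_0_iff)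
  also have "\<dots> = (-1) ^ Suc k / \<eta> ^ (Suc k choose 2)"
    using Suc N by simp
  finally have "\<eta> ^ Suc k * gauss_binom \<eta> N (Suc k) = (-1) ^ Suc k / \<eta> ^ (Suc k choose 2)" .
  moreover have "\<eta> \<noteq> 0"
    using primitive_roots_nonzero[OF \<eta>] Suc.prems by simp
  ultimately show ?case
    by (simp add: N Suc_choose_2[of "Suc k"] power_add field_simps)
qed simp

text \<open>Absorption splits off \<open>(1 - f x ^ (M * d)) / (1 - f x ^ d)\<close>, which tends to
  \<open>M\<close>, and leaves a coefficient of row \<open>M * d - 1\<close>, known at
  \<open>\<eta>\<close>. A general \<open>f\<close> and filter allow the arguments \<open>x\<close>
  and \<open>x\<^sup>2\<close> alike.\<close>

lemma gauss_binom_first_order: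
  assumes \<eta>: "\<eta> \<in> primitive_roots d" and f: "(f \<longlongrightarrow> \<eta>) F" "\<forall>\<^sub>F x in F. f x ^ d \<noteq> 1"
    and "M > 0" "0 < k" "k < d"
  shows "((\<lambda>x. gauss_binom (f x) (M * d) k / (1 - f x ^ d))
           \<longlongrightarrow> of_nat M * (-1) ^ (k - 1) / (\<eta> ^ (k choose 2) * (1 - \<eta> ^ k))) F"
proof -
  obtain N where N: "M * d = Suc N"
    using assms by (cases "M * d") auto
  obtain k' where k: "k = Suc k'"
    using assms by (cases k) auto
  have nz: "1 - \<eta> ^ k \<noteq> 0"
    using \<eta> assms by (auto simp: primitive_roots_def)
  have fd: "((\<lambda>x. f x ^ d) \<longlongrightarrow> 1) F"
    using tendsto_power[OF f(1), of d] \<eta> by (simp add: primitive_roots_def)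
  have fk: "((\<lambda>x. 1 - f x ^ k) \<longlongrightarrow> 1 - \<eta> ^ k) F"
    by (intro tendsto_intros f)
  have "((\<lambda>x. (1 - (f x ^ d) ^ M) / (1 - f x ^ d) * (gauss_binom (f x) N k' / (1 - f x ^ k)))
      \<longlongrightarrow> of_nat M * (gauss_binom \<eta> N k' / (1 - \<eta> ^ k))) F"
    using nz fk by (intro tendsto_mult tendsto_divide tendsto_geometric_quotient fd f(2)
        tendsto_gauss_binom f(1))
  moreover have "gauss_binom \<eta> N k' = (-1) ^ k' / \<eta> ^ (k choose 2)"
    using gauss_binom_root_pred[OF \<eta> \<open>M > 0\<close>, of k'] N k assms by simp
  ultimately have "((\<lambda>x. (1 - (f x ^ d) ^ M) / (1 - f x ^ d) * (gauss_binom (f x) N k' / (1 - f x ^ k)))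
      \<longlongrightarrow> of_nat M * (-1) ^ (k - 1) / (\<eta> ^ (k choose 2) * (1 - \<eta> ^ k))) F"
    by (simp add: k)
  then show ?thesis
  proof (rule Lim_transform_eventually)
    have "\<forall>\<^sub>F x in F. 1 - f x ^ k \<noteq> 0"
      using fk nz by (rule tendsto_imp_eventually_ne)
    then show "\<forall>\<^sub>F x in F. (1 - (f x ^ d) ^ M) / (1 - f x ^ d) * (gauss_binom (f x) N k' / (1 - f x ^ k))
        = gauss_binom (f x) (M * d) k / (1 - f x ^ d)"
    proof eventually_elim
      case (elim x)
      have "gauss_binom (f x) (M * d) k = (1 - (f x ^ d) ^ M) * gauss_binom (f x) N k' / (1 - f x ^ k)"
        using gauss_binom_absorb[of "f x" N k'] elim
        by (simp only: N[symmetric] k[symmetric] power_mult[symmetric] mult.commute[of d]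
              nonzero_eq_divide_eq not_False_eq_True)
      then show ?case by simp
    qed
  qed
qed

text \<open>The product rule at a point where every factor is 1:
  \<open>g * P - 1 = (g - 1) * P + (P - 1)\<close>.\<close>

lemma tendsto_prod_first_order:
  fixes f :: "'i \<Rightarrow> 'b \<Rightarrow> 'a::real_normed_field"
  assumes "finite S" "(u \<longlongrightarrow> 0) F" "\<forall>\<^sub>F x in F. u x \<noteq> 0"
    and "\<And>i. i \<in> S \<Longrightarrow> ((\<lambda>x. (f i x - 1) / u x) \<longlongrightarrow> a i) F"
  shows "((\<lambda>x. ((\<Prod>i\<in>S. f i x) - 1) / u x) \<longlongrightarrow> (\<Sum>i\<in>S. a i)) F"
  using assms(1,4)
proof (induction S)
  case (insert s S)
  let ?P = "\<lambda>x. \<Prod>i\<in>S. f i x"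
  have IH: "((\<lambda>x. (?P x - 1) / u x) \<longlongrightarrow> (\<Sum>i\<in>S. a i)) F"
    using insert by simp
  \<comment> \<open>A finite limit of \<open>(?P x - 1) / u x\<close> together with
    \<open>u x\<close> tending to 0 forces \<open>?P x\<close> to tend to 1.\<close>
  have "((\<lambda>x. 1 + (?P x - 1) / u x * u x) \<longlongrightarrow> 1 + (\<Sum>i\<in>S. a i) * 0) F"
    by (intro tendsto_intros IH assms)
  then have "((\<lambda>x. 1 + (?P x - 1) / u x * u x) \<longlongrightarrow> 1) F"
    by simp
  then have P: "(?P \<longlongrightarrow> 1) F"
    by (rule Lim_transform_eventually) (use assms(3) in eventually_elim, simp)
  have "((\<lambda>x. (f s x - 1) / u x * ?P x + (?P x - 1) / u x) \<longlongrightarrow> a s * 1 + (\<Sum>i\<in>S. a i)) F"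
    by (intro tendsto_intros IH P insert) simp
  moreover have "(f s x - 1) / u x * ?P x + (?P x - 1) / u x = (f s x * ?P x - 1) / u x" for x
    by (simp add: algebra_simps diff_divide_distrib)
  ultimately show ?case
    using insert by simp
qed simp

text \<open>The exponents \<open>Suc i\<close> and \<open>p - i\<close> add up to the order of
  \<open>\<eta>\<close>, so the two powers are inverse to each other and their quotients add up to
  \<open>-1\<close>. Doubling the sum therefore gives \<open>- p\<close>.\<close>

lemma sum_root_quotients:
  assumes \<eta>: "\<eta> \<in> primitive_roots (Suc p)"
  shows "(\<Sum>i<p. \<eta> ^ (p - i) / (1 - \<eta> ^ (p - i))) = - of_nat p / 2"
proof -
  define a where "a j = \<eta> ^ j / (1 - \<eta> ^ j)" for j
  have "(\<Sum>i<p. a (p - i)) = (\<Sum>i<p. a (Suc (p - Suc i)))"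
    by (intro sum.cong refl) (simp add: Suc_diff_Suc)
  also have "\<dots> = (\<Sum>i<p. a (Suc i))"
    by (rule sum.nat_diff_reindex)
  finally have "2 * (\<Sum>i<p. a (p - i)) = (\<Sum>i<p. a (Suc i) + a (p - i))"
    by (simp add: sum.distrib)
  also have "\<dots> = (\<Sum>i<p. - 1)"
  proof (intro sum.cong refl)
    fix i assume "i \<in> {..<p}"
    then have i: "i < p" by simp
    have "\<eta> ^ Suc i * \<eta> ^ (p - i) = \<eta> ^ (Suc i + (p - i))"
      by (simp only: power_add)
    also have "Suc i + (p - i) = Suc p"
      using i by simp
    finally have 1: "\<eta> ^ Suc i * \<eta> ^ (p - i) = 1"
      using \<eta> by (simp add: primitive_roots_def del: power_Suc)
    have 2: "1 - \<eta> ^ Suc i \<noteq> 0" "1 - \<eta> ^ (p - i) \<noteq> 0"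
      using \<eta> i by (auto simp: primitive_roots_def simp del: power_Suc)
    have "X / (1 - X) + Y / (1 - Y) = - 1" if "X * Y = 1" "1 - X \<noteq> 0" "1 - Y \<noteq> 0" for X Y :: complex
    proof -
      have "X / (1 - X) + Y / (1 - Y) = (X * (1 - Y) + Y * (1 - X)) / ((1 - X) * (1 - Y))"
        using that by (simp only: add_frac_eq not_False_eq_True)
      also have "X * (1 - Y) + Y * (1 - X) = - ((1 - X) * (1 - Y))"
        using that(1) by (simp add: algebra_simps)
      finally show ?thesis using that by simp
    qed
    from this[OF 1 2] show "a (Suc i) + a (p - i) = - 1"
      unfolding a_def .
  qed
  finally show ?thesis
    unfolding a_def by (simp add: field_simps)
qed

text \<open>By absorption the coefficient is \<open>E x * P x\<close>, with \<open>E x\<close> a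
  geometric sum tending to \<open>M\<close> and \<open>P x\<close> the coefficient of row
  \<open>M * d - 1\<close>, tending to 1. Their first-order terms are
  \<open>- M * (M - 1) / 2\<close> and, by \<open>sum_root_quotients\<close>,
  \<open>- (M - 1) * (d - 1) / 2\<close>.\<close>

lemma gauss_binom_second_order:
  assumes \<eta>: "\<eta> \<in> primitive_roots d" and f: "(f \<longlongrightarrow> \<eta>) F" "\<forall>\<^sub>F x in F. f x ^ d \<noteq> 1"
    and "M > 0" "d > 0"
  shows "((\<lambda>x. (gauss_binom (f x) (M * d) d - of_nat M) / (1 - f x ^ d))
           \<longlongrightarrow> - (of_nat d * of_nat M * (of_nat M - 1) / 2)) F"
proof -
  obtain N where N: "M * d = Suc N"
    using assms by (cases "M * d") auto
  obtain p where p: "d = Suc p"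
    using assms by (cases d) auto
  define u where "u x = 1 - f x ^ d" for x
  define E where "E x = (\<Sum>i<M. (f x ^ d) ^ i)" for x
  define P where "P x = (\<Prod>i<p. (1 - f x ^ (N - i)) / (1 - f x ^ (p - i)))" for x
  have fd: "((\<lambda>x. f x ^ d) \<longlongrightarrow> 1) F"
    using tendsto_power[OF f(1), of d] \<eta> by (simp add: primitive_roots_def)
  have u: "(u \<longlongrightarrow> 0) F" "\<forall>\<^sub>F x in F. u x \<noteq> 0"
    unfolding u_def using tendsto_diff[OF tendsto_const fd, of 1] f(2) by (auto elim: eventually_mono)
  have nz: "1 - \<eta> ^ i \<noteq> 0" if "0 < i" "i \<le> p" for i
    using \<eta> that p by (auto simp: primitive_roots_def)
  have fi: "((\<lambda>x. 1 - f x ^ i) \<longlongrightarrow> 1 - \<eta> ^ i) F" for i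
    by (intro tendsto_intros f)
  have "\<forall>\<^sub>F x in F. 1 - f x ^ i \<noteq> 0" if "i \<in> {1..p}" for i
    using fi by (rule tendsto_imp_eventually_ne) (use nz that in auto)
  then have ev: "\<forall>\<^sub>F x in F. \<forall>i\<in>{1..p}. 1 - f x ^ i \<noteq> 0"
    by (intro eventually_ball_finite) auto
  have "((\<lambda>x. (P x - 1) / u x) \<longlongrightarrow> (\<Sum>i<p. (of_nat M - 1) * (\<eta> ^ (p - i) / (1 - \<eta> ^ (p - i))))) F"
    unfolding P_def
  proof (rule tendsto_prod_first_order[OF _ u])
    fix i assume "i \<in> {..<p}"
    then have i: "i < p" by simp
    have "((\<lambda>x. (1 - (f x ^ d) ^ (M - 1)) / (1 - f x ^ d) * (f x ^ (p - i) / (1 - f x ^ (p - i))))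
       \<longlongrightarrow> of_nat (M - 1) * (\<eta> ^ (p - i) / (1 - \<eta> ^ (p - i)))) F"
      using nz[of "p - i"] i
      by (intro tendsto_mult tendsto_divide tendsto_geometric_quotient fd f(2) fi tendsto_power f(1)) auto
    then have "((\<lambda>x. (1 - (f x ^ d) ^ (M - 1)) / (1 - f x ^ d) * (f x ^ (p - i) / (1 - f x ^ (p - i))))
       \<longlongrightarrow> (of_nat M - 1) * (\<eta> ^ (p - i) / (1 - \<eta> ^ (p - i)))) F"
      using \<open>M > 0\<close> by (simp add: of_nat_diff)
    then show "((\<lambda>x. ((1 - f x ^ (N - i)) / (1 - f x ^ (p - i)) - 1) / u x)
       \<longlongrightarrow> (of_nat M - 1) * (\<eta> ^ (p - i) / (1 - \<eta> ^ (p - i)))) F"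
    proof (rule Lim_transform_eventually)
      show "\<forall>\<^sub>F x in F. (1 - (f x ^ d) ^ (M - 1)) / (1 - f x ^ d) * (f x ^ (p - i) / (1 - f x ^ (p - i)))
        = ((1 - f x ^ (N - i)) / (1 - f x ^ (p - i)) - 1) / u x"
        using ev u(2)
      proof eventually_elim
        case (elim x)
        have nz': "1 - f x ^ (p - i) \<noteq> 0"
          using elim i by auto
        \<comment> \<open>Numerator and denominator exponents differ by a multiple of
          \<open>d\<close>, so this factor is 1 up to a multiple of
          \<open>1 - (f x ^ d) ^ (M - 1)\<close>.\<close>
        have "N - i = (p - i) + d * (M - 1)"
          using N p i \<open>M > 0\<close> by (cases M) (auto simp: algebra_simps)
        then have e: "f x ^ (N - i) = f x ^ (p - i) * (f x ^ d) ^ (M - 1)"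
          by (simp add: power_add power_mult)
        have "(1 - X * V) / (1 - X) - 1 = (1 - V) * (X / (1 - X))" if "1 - X \<noteq> 0" for X V :: complex
          using that by (simp add: field_simps)
        from this[OF nz'] show ?case
          unfolding e u_def by simp
      qed
    qed
  qed auto
  also have "(\<Sum>i<p. (of_nat M - 1) * (\<eta> ^ (p - i) / (1 - \<eta> ^ (p - i))))
      = (of_nat M - 1) * (- of_nat p / 2 :: complex)"
    unfolding sum_distrib_left[symmetric] using sum_root_quotients[of \<eta> p] \<eta> p by simp
  finally have P1: "((\<lambda>x. (P x - 1) / u x) \<longlongrightarrow> (of_nat M - 1) * (- of_nat p / 2)) F" .
  have "((\<lambda>x. 1 + (P x - 1) / u x * u x) \<longlongrightarrow> 1 + (of_nat M - 1) * (- of_nat p / 2) * 0) F"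
    by (intro tendsto_intros P1 u)
  then have "((\<lambda>x. 1 + (P x - 1) / u x * u x) \<longlongrightarrow> 1) F"
    by simp
  then have P0: "(P \<longlongrightarrow> 1) F"
    by (rule Lim_transform_eventually) (use u(2) in eventually_elim, simp)
  \<comment> \<open>Subtracting 1 from each of the \<open>M\<close> terms of \<open>E x\<close>
    leaves quotients that tend to \<open>i\<close>.\<close>
  have "((\<lambda>x. - (\<Sum>i<M. (1 - (f x ^ d) ^ i) / (1 - f x ^ d))) \<longlongrightarrow> - (\<Sum>i<M. of_nat i)) F"
    by (intro tendsto_intros tendsto_geometric_quotient fd f)
  moreover have "(\<Sum>i<M. of_nat i :: complex) = of_nat M * (of_nat M - 1) / 2"
    by (induction M) (auto simp: field_simps)
  moreover have "- (\<Sum>i<M. (1 - (f x ^ d) ^ i) / (1 - f x ^ d)) = (E x - of_nat M) / u x" for x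
    unfolding E_def u_def sum_divide_distrib[symmetric] by (simp add: sum_subtractf diff_divide_distrib)
  ultimately have E1: "((\<lambda>x. (E x - of_nat M) / u x) \<longlongrightarrow> - (of_nat M * (of_nat M - 1) / 2)) F"
    by simp
  have "((\<lambda>x. (E x - of_nat M) / u x * P x + of_nat M * ((P x - 1) / u x))
      \<longlongrightarrow> - (of_nat M * (of_nat M - 1) / 2) * 1 + of_nat M * ((of_nat M - 1) * (- of_nat p / 2))) F"
    by (intro tendsto_intros E1 P0 P1)
  also have "- (of_nat M * (of_nat M - 1) / 2) * 1 + of_nat M * ((of_nat M - 1) * (- of_nat p / 2))
     = (- (of_nat d * of_nat M * (of_nat M - 1) / 2) :: complex)"
    by (simp add: p field_simps)
  finally show ?thesis
  proof (rule Lim_transform_eventually)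
    show "\<forall>\<^sub>F x in F. (E x - of_nat M) / u x * P x + of_nat M * ((P x - 1) / u x)
       = (gauss_binom (f x) (M * d) d - of_nat M) / (1 - f x ^ d)"
      using ev u(2)
    proof eventually_elim
      case (elim x)
      let ?D = "\<Prod>i=1..p. 1 - f x ^ i"
      have "?D \<noteq> 0"
        using elim by (simp add: prod_zero_iff)
      have "?D = (\<Prod>i<p. 1 - f x ^ (p - i))"
        using gauss_binom_prod[of "f x" p p] by simp
      then have G: "gauss_binom (f x) N p = P x"
        unfolding P_def prod_dividef using gauss_binom_prod[of "f x" N p] \<open>?D \<noteq> 0\<close>
        by (simp add: nonzero_eq_divide_eq)
      have "gauss_binom (f x) (M * d) d * u x = (1 - (f x ^ d) ^ M) * P x"
        using gauss_binom_absorb[of "f x" N p]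
        by (simp only: N[symmetric] p[symmetric] G u_def power_mult[symmetric] mult.commute[of d])
      also have "\<dots> = E x * P x * u x"
        unfolding one_diff_power_eq E_def u_def by (simp add: mult_ac)
      finally have "gauss_binom (f x) (M * d) d = E x * P x"
        using elim by simp
      then show ?case
        by (simp add: u_def[symmetric] algebra_simps diff_divide_distrib)
    qed
  qed
qed

text \<open>An instance of the q-Lucas theorem: at \<open>\<eta>\<close> the exponents in the
  product formula matter only modulo \<open>d\<close>.\<close>

lemma gauss_binom_root_period:
  assumes \<eta>: "\<eta> \<in> primitive_roots d" and "s < d"
  shows "gauss_binom \<eta> (d + s) s = 1"
proof -
  have "(\<Prod>i=1..s. 1 - \<eta> ^ i) \<noteq> 0"
    using assms by (auto simp: primitive_roots_def)
  moreover have "(\<Prod>i<s. 1 - \<eta> ^ (d + s - i)) = (\<Prod>i<s. 1 - \<eta> ^ (s - i))"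
  proof (intro prod.cong refl)
    fix i assume "i \<in> {..<s}"
    then have "d + s - i = d + (s - i)" by simp
    then show "1 - \<eta> ^ (d + s - i) = 1 - \<eta> ^ (s - i)"
      using \<eta> by (simp add: power_add primitive_roots_def)
  qed
  ultimately show ?thesis
    using gauss_binom_prod[of \<eta> "d + s" s] gauss_binom_prod[of \<eta> s s] by simp
qed

lemma tendsto_gauss_binom_multiple:
  assumes \<eta>: "\<eta> \<in> primitive_roots d" and f: "(f \<longlongrightarrow> \<eta>) F" "\<forall>\<^sub>F x in F. f x ^ d \<noteq> 1"
    and "M > 0" "d > 0"
  shows "((\<lambda>x. gauss_binom (f x) (M * d) d) \<longlongrightarrow> of_nat M) F"
proof -
  let ?g = "\<lambda>x. (gauss_binom (f x) (M * d) d - of_nat M) / (1 - f x ^ d)"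
  have "((\<lambda>x. of_nat M + ?g x * (1 - f x ^ d))
    \<longlongrightarrow> of_nat M + - (of_nat d * of_nat M * (of_nat M - 1) / 2) * (1 - \<eta> ^ d)) F"
    by (intro tendsto_intros gauss_binom_second_order[OF \<eta> f] assms)
  moreover have "\<eta> ^ d = 1"
    using \<eta> by (simp add: primitive_roots_def)
  ultimately have "((\<lambda>x. of_nat M + ?g x * (1 - f x ^ d)) \<longlongrightarrow> of_nat M) F"
    by simp
  then show ?thesis
    by (rule Lim_transform_eventually) (use f(2) in eventually_elim, simp)
qed

text \<open>Trinomial revision removes a full period \<open>d\<close> from the lower index, leaving
  three coefficients with known behaviour. This case arises for even \<open>n\<close>, where
  \<open>\<zeta>\<^sup>2\<close> has order \<open>n / 2\<close> while \<open>k\<close> runs up to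
  \<open>n\<close>.\<close>

lemma gauss_binom_first_order_above:
  assumes \<eta>: "\<eta> \<in> primitive_roots d" and f: "(f \<longlongrightarrow> \<eta>) F" "\<forall>\<^sub>F x in F. f x ^ d \<noteq> 1"
    and "M > 1" "0 < s" "s < d"
  shows "((\<lambda>x. gauss_binom (f x) (M * d) (d + s) / (1 - f x ^ d))
           \<longlongrightarrow> of_nat M * (of_nat (M - 1) * (-1) ^ (s - 1) / (\<eta> ^ (s choose 2) * (1 - \<eta> ^ s)))) F"
proof -
  have G: "((\<lambda>x. gauss_binom (f x) (d + s) s) \<longlongrightarrow> 1) F"
    using tendsto_gauss_binom[OF f(1), of "d + s" s] gauss_binom_root_period[OF \<eta> \<open>s < d\<close>] by simp
  have "((\<lambda>x. gauss_binom (f x) (M * d) d * (gauss_binom (f x) ((M - 1) * d) s / (1 - f x ^ d))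
          / gauss_binom (f x) (d + s) s)
       \<longlongrightarrow> of_nat M * (of_nat (M - 1) * (-1) ^ (s - 1) / (\<eta> ^ (s choose 2) * (1 - \<eta> ^ s))) / 1) F"
    using assms by (intro tendsto_mult tendsto_divide tendsto_gauss_binom_multiple
        gauss_binom_first_order G) auto
  then have "((\<lambda>x. gauss_binom (f x) (M * d) d * (gauss_binom (f x) ((M - 1) * d) s / (1 - f x ^ d))
          / gauss_binom (f x) (d + s) s)
       \<longlongrightarrow> of_nat M * (of_nat (M - 1) * (-1) ^ (s - 1) / (\<eta> ^ (s choose 2) * (1 - \<eta> ^ s)))) F"
    by simp
  then show ?thesis
  proof (rule Lim_transform_eventually)
    have "\<forall>\<^sub>F x in F. gauss_binom (f x) (d + s) s \<noteq> 0"
      using G by (rule tendsto_imp_eventually_ne) simp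
    then show "\<forall>\<^sub>F x in F. gauss_binom (f x) (M * d) d * (gauss_binom (f x) ((M - 1) * d) s / (1 - f x ^ d))
          / gauss_binom (f x) (d + s) s = gauss_binom (f x) (M * d) (d + s) / (1 - f x ^ d)"
    proof eventually_elim
      case (elim x)
      have "M * d - d = (M - 1) * d"
        by (simp add: diff_mult_distrib)
      then have "gauss_binom (f x) (M * d) (d + s)
        = gauss_binom (f x) (M * d) d * gauss_binom (f x) ((M - 1) * d) s / gauss_binom (f x) (d + s) s"
        using gauss_binom_trinomial_revision[of "f x" "M * d" d s] elim
        by (simp add: nonzero_eq_divide_eq)
      then show ?case by simp
    qed
  qed
qed

text \<open>The analogue of \<open>gauss_binom_second_order\<close> for two periods, used for the
  summand \<open>k = n\<close> with \<open>n\<close> even. Trinomial revision writes the coefficient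
  as \<open>a x * b x / c x\<close>, whose factors tend to \<open>2 * m\<close>,
  \<open>2 * m - 1\<close> and 2.\<close>

lemma gauss_binom_second_order_double:
  assumes \<eta>: "\<eta> \<in> primitive_roots l" and f: "(f \<longlongrightarrow> \<eta>) F" "\<forall>\<^sub>F x in F. f x ^ l \<noteq> 1"
    and "m > 0" "l > 0"
  shows "((\<lambda>x. (gauss_binom (f x) (2 * m * l) (2 * l) - (2 * of_nat m - 1) * of_nat m) / (1 - f x ^ l))
           \<longlongrightarrow> - ((2 * of_nat m - 1) * (2 * of_nat l * of_nat m * (of_nat m - 1)))) F"
proof -
  define u where "u x = 1 - f x ^ l" for x
  define a where "a x = gauss_binom (f x) (2 * m * l) l" for x
  define b where "b x = gauss_binom (f x) ((2 * m - 1) * l) l" for x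
  define c where "c x = gauss_binom (f x) (2 * l) l" for x
  have of_nat_pred: "of_nat (2 * m - 1) = (2 * of_nat m - 1 :: complex)"
    using \<open>m > 0\<close> by (simp add: of_nat_diff)
  have a1: "((\<lambda>x. (a x - 2 * of_nat m) / u x) \<longlongrightarrow> - (of_nat l * of_nat m * (2 * of_nat m - 1))) F"
    using gauss_binom_second_order[OF \<eta> f, of "2 * m"] assms unfolding a_def u_def by (simp add: mult.assoc)
  have b0: "(b \<longlongrightarrow> 2 * of_nat m - 1) F"
    using tendsto_gauss_binom_multiple[OF \<eta> f, of "2 * m - 1"] assms
    unfolding b_def of_nat_pred by simp
  have b1: "((\<lambda>x. (b x - (2 * of_nat m - 1)) / u x)
      \<longlongrightarrow> - (of_nat l * (2 * of_nat m - 1) * (of_nat m - 1))) F"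
  proof -
    have eq: "of_nat l * (2 * of_nat m - 1) * (2 * of_nat m - 1 - 1) / 2
        = (of_nat l * (2 * of_nat m - 1) * (of_nat m - 1) :: complex)"
      by (simp add: field_simps)
    show ?thesis
      using gauss_binom_second_order[OF \<eta> f, of "2 * m - 1"] assms
      unfolding b_def u_def of_nat_pred eq by simp
  qed
  have c0: "(c \<longlongrightarrow> 2) F"
    using tendsto_gauss_binom_multiple[OF \<eta> f, of 2] assms unfolding c_def by simp
  have c1: "((\<lambda>x. (c x - 2) / u x) \<longlongrightarrow> - of_nat l) F"
    using gauss_binom_second_order[OF \<eta> f, of 2] assms unfolding c_def u_def by simp
  \<comment> \<open>The numerator is \<open>a x * b x - (2 * m - 1) * m * c x\<close>, telescoped so
    that each part contains one known first-order quotient.\<close>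
  have "((\<lambda>x. ((a x - 2 * of_nat m) / u x * b x
           + 2 * of_nat m * ((b x - (2 * of_nat m - 1)) / u x)
           - (2 * of_nat m - 1) * of_nat m * ((c x - 2) / u x)) / c x)
     \<longlongrightarrow> (- (of_nat l * of_nat m * (2 * of_nat m - 1)) * (2 * of_nat m - 1)
           + 2 * of_nat m * (- (of_nat l * (2 * of_nat m - 1) * (of_nat m - 1)))
           - (2 * of_nat m - 1) * of_nat m * (- of_nat l)) / 2) F"
    by (intro tendsto_intros a1 b0 b1 c0 c1) simp
  also have "(- (of_nat l * of_nat m * (2 * of_nat m - 1)) * (2 * of_nat m - 1)
           + 2 * of_nat m * (- (of_nat l * (2 * of_nat m - 1) * (of_nat m - 1)))
           - (2 * of_nat m - 1) * of_nat m * (- of_nat l)) / 2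
     = (- ((2 * of_nat m - 1) * (2 * of_nat l * of_nat m * (of_nat m - 1))) :: complex)"
    by (simp add: field_simps)
  finally show ?thesis
  proof (rule Lim_transform_eventually)
    have "\<forall>\<^sub>F x in F. c x \<noteq> 0"
      using c0 by (rule tendsto_imp_eventually_ne) simp
    then show "\<forall>\<^sub>F x in F. ((a x - 2 * of_nat m) / u x * b x
           + 2 * of_nat m * ((b x - (2 * of_nat m - 1)) / u x)
           - (2 * of_nat m - 1) * of_nat m * ((c x - 2) / u x)) / c x
       = (gauss_binom (f x) (2 * m * l) (2 * l) - (2 * of_nat m - 1) * of_nat m) / (1 - f x ^ l)"
    proof eventually_elim
      case (elim x)
      have "2 * m * l - l = (2 * m - 1) * l"
        by (simp add: diff_mult_distrib)
      then have "gauss_binom (f x) (2 * m * l) (2 * l) * c x = a x * b x"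
        using gauss_binom_trinomial_revision[of "f x" "2 * m * l" l l]
        unfolding a_def b_def c_def by (simp add: mult_2)
      then have "gauss_binom (f x) (2 * m * l) (2 * l) = a x * b x / c x"
        using elim by (simp add: nonzero_eq_divide_eq)
      moreover have "((a x - 2 * of_nat m) / u x * b x
           + 2 * of_nat m * ((b x - (2 * of_nat m - 1)) / u x)
           - (2 * of_nat m - 1) * of_nat m * ((c x - 2) / u x))
         = (a x * b x - (2 * of_nat m - 1) * of_nat m * c x) / u x"
        by (simp add: algebra_simps diff_divide_distrib add_divide_distrib)
      ultimately show ?case
        using elim by (simp add: u_def[symmetric] diff_divide_distrib divide_divide_eq_left mult.commute)
    qed
  qed
qed

section \<open>Limits of the summands\<close>

lemma prod_neg_powers:
  fixes q :: "'a::comm_ring_1"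
  shows "(\<Prod>i<j. - (q ^ (a + i))) = (-1) ^ j * q ^ (a * j + (j choose 2))"
  by (induction j) (simp_all add: Suc_choose_2 power_add mult_ac)

text \<open>Modulo \<open>n\<close> the numerator on the left has the exponents \<open>j + 1\<close>
  to \<open>2 * j\<close>. Replacing each exponent by its negative turns the numerator on the right
  into the exponents \<open>j\<close> to \<open>2 * j - 1\<close>, up to sign and a power of
  \<open>\<zeta>\<close>. The shift by one costs \<open>(1 - \<zeta> ^ (2 * j)) / (1 - \<zeta> ^ j)
  = 1 + \<zeta> ^ j\<close>.\<close>

lemma gauss_binom_root_reflection:
  assumes \<zeta>: "\<zeta> \<in> primitive_roots n" and "0 < j" "j < n"
  shows "gauss_binom \<zeta> (a * n + 2 * j) j
    = (-1) ^ j * \<zeta> ^ (j * (j + 1) + (j choose 2)) * (1 + \<zeta> ^ (n - j)) * gauss_binom \<zeta> (n - j) j"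
    (is "?L = ?C * (1 + _) * ?R")
proof -
  let ?D = "\<Prod>i=1..j. 1 - \<zeta> ^ i"
  have D: "?D \<noteq> 0"
    using assms by (auto simp: primitive_roots_def)
  have \<zeta>n: "\<zeta> ^ n = 1"
    using \<zeta> by (simp add: primitive_roots_def)
  have "?L * ?D = (\<Prod>i<j. 1 - \<zeta> ^ (2 * j - i))"
    unfolding gauss_binom_prod
  proof (intro prod.cong refl)
    fix i assume "i \<in> {..<j}"
    then have "a * n + 2 * j - i = a * n + (2 * j - i)" by simp
    then show "1 - \<zeta> ^ (a * n + 2 * j - i) = 1 - \<zeta> ^ (2 * j - i)"
      by (simp add: power_add primitive_roots_power_mult[OF \<zeta>])
  qed
  also have "\<dots> = ?C * (1 + \<zeta> ^ (n - j)) * ?R * ?D"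
  proof (cases "2 * j \<le> n")
    case False
    \<comment> \<open>Here the range of exponents contains \<open>n\<close>, reached at
      \<open>i = 2 * j - n\<close>, and the right side is zero because
      \<open>n - j < j\<close>.\<close>
    have "(\<Prod>i<j. 1 - \<zeta> ^ (2 * j - i)) = 0"
    proof (rule prod_zero)
      show "\<exists>i\<in>{..<j}. 1 - \<zeta> ^ (2 * j - i) = 0"
        using False \<open>j < n\<close> \<zeta>n by (intro bexI[of _ "2 * j - n"]) auto
    qed simp
    then show ?thesis
      using False by (simp add: gauss_binom_eq_0)
  next
    case True
    \<comment> \<open>Since \<open>n - j - i\<close> is the negative of \<open>j + i\<close> modulo
      \<open>n\<close>, each factor on the right arises from its inverse counterpart.\<close>
    have "(\<Prod>i<j. - (\<zeta> ^ (j + i))) * (\<Prod>i<j. 1 - \<zeta> ^ (n - j - i)) = (\<Prod>i<j. 1 - \<zeta> ^ (j + i))"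
      unfolding prod.distrib[symmetric]
    proof (intro prod.cong refl)
      fix i assume "i \<in> {..<j}"
      then have "\<zeta> ^ (j + i) * \<zeta> ^ (n - j - i) = 1"
        unfolding power_add[symmetric] using True \<zeta>n by simp
      then show "- (\<zeta> ^ (j + i)) * (1 - \<zeta> ^ (n - j - i)) = 1 - \<zeta> ^ (j + i)"
        by (simp add: algebra_simps)
    qed
    then have 1: "(-1) ^ j * \<zeta> ^ (j * j + (j choose 2)) * (?R * ?D) = (\<Prod>i<j. 1 - \<zeta> ^ (j + i))"
      unfolding prod_neg_powers gauss_binom_prod .
    have 2: "\<zeta> ^ j * (1 + \<zeta> ^ (n - j)) = 1 + \<zeta> ^ j"
      using \<open>j < n\<close> \<zeta>n by (simp add: distrib_left flip: power_add)
    have "?C * (1 + \<zeta> ^ (n - j)) * ?R * ?D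
        = (\<zeta> ^ j * (1 + \<zeta> ^ (n - j))) * ((-1) ^ j * \<zeta> ^ (j * j + (j choose 2)) * (?R * ?D))"
      by (simp add: power_add mult_ac)
    also have "\<dots> = (1 + \<zeta> ^ j) * (\<Prod>i<j. 1 - \<zeta> ^ (j + i))"
      unfolding 1 2 ..
    finally have R: "?C * (1 + \<zeta> ^ (n - j)) * ?R * ?D = (1 + \<zeta> ^ j) * (\<Prod>i<j. 1 - \<zeta> ^ (j + i))" .
    have "(\<Prod>i<j. 1 - \<zeta> ^ (2 * j - i)) = (\<Prod>i<j. 1 - \<zeta> ^ (j + Suc (j - Suc i)))"
      by (intro prod.cong refl) (simp add: Suc_diff_Suc mult_2)
    also have "\<dots> = (\<Prod>i<j. 1 - \<zeta> ^ (j + Suc i))"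
      by (rule prod.nat_diff_reindex)
    finally have "(1 - \<zeta> ^ j) * (\<Prod>i<j. 1 - \<zeta> ^ (2 * j - i)) = (\<Prod>i<Suc j. 1 - \<zeta> ^ (j + i))"
      by (subst prod.lessThan_Suc_shift) simp
    also have "\<dots> = (\<Prod>i<j. 1 - \<zeta> ^ (j + i)) * (1 - \<zeta> ^ j * \<zeta> ^ j)"
      by (simp add: power_add)
    also have "\<dots> = (1 - \<zeta> ^ j) * (?C * (1 + \<zeta> ^ (n - j)) * ?R * ?D)"
      unfolding R by (simp add: algebra_simps)
    finally have "(1 - \<zeta> ^ j) * (\<Prod>i<j. 1 - \<zeta> ^ (2 * j - i))
       = (1 - \<zeta> ^ j) * (?C * (1 + \<zeta> ^ (n - j)) * ?R * ?D)" .
    moreover have "1 - \<zeta> ^ j \<noteq> 0"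
      using assms by (auto simp: primitive_roots_def)
    ultimately show ?thesis
      by (simp only: mult_cancel_left simp_thms)
  qed
  finally show ?thesis
    using D by (simp only: mult_cancel_right simp_thms)
qed

lemma two_choose_2: "2 * (k choose 2) = k * (k - 1)"
  unfolding choose_two by (rule dvd_mult_div_cancel) (cases k, simp_all)

section \<open>Squares of primitive roots of unity\<close>

lemma one_minus_square_power:
  fixes x :: "'a::comm_ring_1"
  shows "1 - (x\<^sup>2) ^ k = (1 - x ^ k) * (1 + x ^ k)"
  by (simp add: power2_eq_square power_mult_distrib algebra_simps)

lemma square_primitive_root_odd:
  assumes "\<zeta> \<in> primitive_roots n" "odd n"
  shows "\<zeta>\<^sup>2 \<in> primitive_roots n"
proof -
  have "\<zeta> ^ (2 * i) \<noteq> 1" if "0 < i" "i < n" for i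
  proof
    assume 1: "\<zeta> ^ (2 * i) = 1"
    show False
    proof (cases "2 * i < n")
      case True
      then show False using 1 assms that by (auto simp: primitive_roots_def)
    next
      case False
      then have "\<zeta> ^ (2 * i) = \<zeta> ^ n * \<zeta> ^ (2 * i - n)"
        by (simp flip: power_add)
      then have "\<zeta> ^ (2 * i - n) = 1"
        using 1 assms by (simp add: primitive_roots_def)
      moreover have "2 * i - n \<noteq> 0" "2 * i - n < n"
        using \<open>odd n\<close> False that by (auto elim: oddE)
      ultimately show False
        using assms by (auto simp: primitive_roots_def)
    qed
  qed
  then show ?thesis
    using assms by (simp add: primitive_roots_def power_mult[symmetric])
      (metis mult.commute power_mult power_one)
qed

lemma square_primitive_root_even:
  assumes "\<zeta> \<in> primitive_roots (2 * l)"
  shows "\<zeta>\<^sup>2 \<in> primitive_roots l"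
  using assms by (simp add: primitive_roots_def power_mult[symmetric])

lemma primitive_root_even_half:
  assumes "\<zeta> \<in> primitive_roots (2 * l)" "l > 0"
  shows "\<zeta> ^ l = - 1"
proof -
  have "(\<zeta> ^ l)\<^sup>2 = 1" "\<zeta> ^ l \<noteq> 1"
    using assms by (auto simp: primitive_roots_def power_mult[symmetric] mult.commute)
  then show ?thesis
    by (simp add: power2_eq_1_iff)
qed

lemma eventually_power_neq_1:
  fixes \<zeta> :: complex
  assumes "n > 0"
  shows "\<forall>\<^sub>F x in at \<zeta>. x ^ n \<noteq> 1"
proof -
  have "finite ({x::complex. x ^ n = 1} - {\<zeta>})"
    using finite_roots_unity[of n, where 'a = complex] assms by simp
  then have "open (- ({x::complex. x ^ n = 1} - {\<zeta>}))"
    by (intro open_Compl finite_imp_closed)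
  then have "\<forall>\<^sub>F x in nhds \<zeta>. x \<in> - ({x::complex. x ^ n = 1} - {\<zeta>})"
    by (intro eventually_nhds_in_open) auto
  then show ?thesis
    unfolding eventually_at_filter by (rule eventually_mono) auto
qed

definition calA_coeff :: "nat \<Rightarrow> complex \<Rightarrow> nat \<Rightarrow> complex" where
  "calA_coeff n \<zeta> j = (-1) ^ j * \<zeta> ^ (j choose 2) * gauss_binom \<zeta> (n - j) j / (1 - \<zeta> ^ (n - j))"

text \<open>In \<open>calA_ring_expansion\<close> every denominator has an exponent strictly between
  0 and \<open>n\<close>, so the sum is continuous at \<open>\<zeta>\<close> itself.\<close>

lemma tendsto_calA_ring:
  assumes \<zeta>: "\<zeta> \<in> primitive_roots n" and "n > 0"
  shows "((\<lambda>x. (calA_ring n x - 1) / (1 - x ^ n)) \<longlongrightarrow> (\<Sum>j=1..<n. calA_coeff n \<zeta> j)) (at \<zeta>)"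
proof -
  have nz: "1 - \<zeta> ^ i \<noteq> 0" if "0 < i" "i < n" for i
    using \<zeta> that by (auto simp: primitive_roots_def)
  have "((\<lambda>x. \<Sum>j=1..<n. (-1) ^ j * x ^ (j choose 2) * gauss_binom x (n - j) j / (1 - x ^ (n - j)))
       \<longlongrightarrow> (\<Sum>j=1..<n. calA_coeff n \<zeta> j)) (at \<zeta>)"
    unfolding calA_coeff_def
    by (intro tendsto_sum tendsto_divide tendsto_mult tendsto_diff tendsto_power tendsto_const
        tendsto_ident_at tendsto_gauss_binom nz) auto
  then show ?thesis
  proof (rule Lim_transform_eventually)
    have "\<forall>\<^sub>F x in at \<zeta>. \<forall>i\<in>{1..n}. x ^ i \<noteq> 1"
      by (intro eventually_ball_finite ballI eventually_power_neq_1) auto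
    then show "\<forall>\<^sub>F x in at \<zeta>. (\<Sum>j=1..<n. (-1) ^ j * x ^ (j choose 2) * gauss_binom x (n - j) j / (1 - x ^ (n - j)))
        = (calA_ring n x - 1) / (1 - x ^ n)"
    proof eventually_elim
      case (elim x)
      then have "1 - x ^ n \<noteq> 0" using \<open>n > 0\<close> by auto
      then show ?case
        using elim by (subst calA_ring_expansion[OF \<open>n > 0\<close>]) auto
    qed
  qed
qed

text \<open>For odd \<open>n\<close> the square of \<open>\<zeta>\<close> again has order
  \<open>n\<close>, so the coefficient in \<open>x\<^sup>2\<close> supplies the zero and the other
  one tends to its reflected value. The factor \<open>1 + \<zeta> ^ k\<close> from the reflection
  cancels against \<open>1 - (\<zeta>\<^sup>2) ^ k\<close>, and \<open>1 + x ^ n\<close> contributes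
  the 2.\<close>

lemma middle_term_odd:
  assumes \<zeta>: "\<zeta> \<in> primitive_roots n" and "m > 0" "odd n" "0 < k" "k < n"
  shows "((\<lambda>x. (-1) ^ k * gauss_binom (x\<^sup>2) (m * n) k * gauss_binom x (2 * (m * n - k)) (n - k) / (1 - x ^ n))
     \<longlongrightarrow> - (2 * of_nat m * calA_coeff n \<zeta> (n - k))) (at \<zeta>)"
proof -
  define j where "j = n - k"
  have j: "0 < j" "j < n" "k = n - j" "k + j = n"
    using assms by (auto simp: j_def)
  have "n > 0" using assms by simp
  have \<eta>: "\<zeta>\<^sup>2 \<in> primitive_roots n"
    by (rule square_primitive_root_odd) fact+
  have sq: "((\<lambda>x. x\<^sup>2) \<longlongrightarrow> \<zeta>\<^sup>2) (at \<zeta>)"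
    by (intro tendsto_intros)
  have ev: "\<forall>\<^sub>F x in at \<zeta>. (x\<^sup>2) ^ n \<noteq> 1"
    using eventually_power_neq_1[of "2 * n" \<zeta>] \<open>n > 0\<close> by (simp add: power_mult)
  have \<zeta>n: "\<zeta> ^ n = 1"
    using \<zeta> by (simp add: primitive_roots_def)
  have lim1: "((\<lambda>x. gauss_binom (x\<^sup>2) (m * n) k / (1 - (x\<^sup>2) ^ n))
      \<longlongrightarrow> of_nat m * (-1) ^ (k - 1) / ((\<zeta>\<^sup>2) ^ (k choose 2) * (1 - (\<zeta>\<^sup>2) ^ k))) (at \<zeta>)"
    using assms by (intro gauss_binom_first_order \<eta> sq ev) auto
  \<comment> \<open>This brings the upper index into the form \<open>a * n + 2 * j\<close> of
    \<open>gauss_binom_root_reflection\<close>, with \<open>a = 2 * (m - 1)\<close>.\<close>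
  have "m * n - k = (m - 1) * n + j"
    using j \<open>m > 0\<close> by (cases m) auto
  then have N: "2 * (m * n - k) = (2 * (m - 1)) * n + 2 * j"
    by simp
  have lim2: "((\<lambda>x. gauss_binom x (2 * (m * n - k)) (n - k))
      \<longlongrightarrow> (-1) ^ j * \<zeta> ^ (j * (j + 1) + (j choose 2)) * (1 + \<zeta> ^ k) * gauss_binom \<zeta> k j) (at \<zeta>)"
    using tendsto_gauss_binom[OF tendsto_ident_at, of "2 * (m * n - k)" j \<zeta> UNIV]
      gauss_binom_root_reflection[OF \<zeta> j(1,2), of "2 * (m - 1)"]
    unfolding N j_def[symmetric] using j(3) by simp
  have "((\<lambda>x. (-1) ^ k * (gauss_binom (x\<^sup>2) (m * n) k / (1 - (x\<^sup>2) ^ n)) * (1 + x ^ n)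
           * gauss_binom x (2 * (m * n - k)) (n - k))
     \<longlongrightarrow> (-1) ^ k * (of_nat m * (-1) ^ (k - 1) / ((\<zeta>\<^sup>2) ^ (k choose 2) * (1 - (\<zeta>\<^sup>2) ^ k))) * (1 + \<zeta> ^ n)
         * ((-1) ^ j * \<zeta> ^ (j * (j + 1) + (j choose 2)) * (1 + \<zeta> ^ k) * gauss_binom \<zeta> k j)) (at \<zeta>)"
    by (intro tendsto_mult lim1 lim2 tendsto_intros)
  also have "(-1) ^ k * (of_nat m * (-1) ^ (k - 1) / ((\<zeta>\<^sup>2) ^ (k choose 2) * (1 - (\<zeta>\<^sup>2) ^ k))) * (1 + \<zeta> ^ n)
         * ((-1) ^ j * \<zeta> ^ (j * (j + 1) + (j choose 2)) * (1 + \<zeta> ^ k) * gauss_binom \<zeta> k j)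
    = - (2 * of_nat m * calA_coeff n \<zeta> (n - k))"
  proof -
    \<comment> \<open>From \<open>k = n - j\<close>, the exponents \<open>k * (k - 1)\<close> and
      \<open>j * (j + 1)\<close> agree modulo \<open>n\<close>; multiples of \<open>n\<close> are
      added on both sides to avoid subtraction.\<close>
    have "k * (k - 1) + n * (2 * j + 1) = n * n + j * (j + 1)"
      unfolding j(4)[symmetric] using \<open>0 < k\<close> by (cases k) (auto simp: algebra_simps)
    then have "\<zeta> ^ (k * (k - 1)) * \<zeta> ^ (n * (2 * j + 1)) = \<zeta> ^ (n * n) * \<zeta> ^ (j * (j + 1))"
      by (simp only: flip: power_add)
    then have 1: "(\<zeta>\<^sup>2) ^ (k choose 2) = \<zeta> ^ (j * (j + 1))"
      unfolding primitive_roots_power_mult[OF \<zeta>] by (simp add: power_mult[symmetric] two_choose_2)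
    note 2 = one_minus_square_power[of \<zeta> k]
    have "1 - (\<zeta>\<^sup>2) ^ k \<noteq> 0"
      using \<eta> assms by (auto simp: primitive_roots_def)
    then have nz: "1 - \<zeta> ^ k \<noteq> 0" "1 + \<zeta> ^ k \<noteq> 0"
      unfolding 2 by auto
    have z: "\<zeta> ^ (j * (j + 1)) \<noteq> 0"
      using primitive_roots_nonzero[OF \<zeta> \<open>n > 0\<close>] by simp
    have s: "(-1) ^ k * (-1) ^ (k - 1) = (- 1 :: complex)"
      using \<open>0 < k\<close> by (cases k) (auto simp flip: power_add)
    have "s1 * (M * s2 / (Z * (U * V))) * (1 + 1) * (S * (Z * C) * V * G) = (s1 * s2) * (2 * M * (S * C * G / U))"
      if "Z \<noteq> 0" "V \<noteq> 0" for s1 s2 M Z U V S C G :: complex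
      using that by (simp add: divide_simps)
    from this[OF z nz(2)] show ?thesis
      unfolding calA_coeff_def 1 2 j_def[symmetric] j(3)[symmetric] \<zeta>n power_add[of \<zeta> "j * (j + 1)"]
      by (simp only: s) simp
  qed
  finally show ?thesis
  proof (rule Lim_transform_eventually)
    show "\<forall>\<^sub>F x in at \<zeta>. (-1) ^ k * (gauss_binom (x\<^sup>2) (m * n) k / (1 - (x\<^sup>2) ^ n)) * (1 + x ^ n)
           * gauss_binom x (2 * (m * n - k)) (n - k)
      = (-1) ^ k * gauss_binom (x\<^sup>2) (m * n) k * gauss_binom x (2 * (m * n - k)) (n - k) / (1 - x ^ n)"
      using ev
    proof eventually_elim
      case (elim x)
      have 2: "1 - (x\<^sup>2) ^ n = (1 - x ^ n) * (1 + x ^ n)"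
          by (rule one_minus_square_power)
      then have "1 + x ^ n \<noteq> 0"
        using elim by auto
      then show ?case
        unfolding 2 by simp
    qed
  qed
qed

text \<open>Now \<open>\<zeta>\<^sup>2\<close> has order \<open>l = n / 2\<close>. For
  \<open>k < l\<close> the limit is 0, because the reflected coefficient is zero. For
  \<open>k = l\<close> the coefficient in \<open>x\<^sup>2\<close> tends to \<open>2 * m\<close>,
  and the zero comes from the other coefficient. For \<open>k > l\<close> one full period is split
  off.\<close>

lemma middle_term_even:
  assumes \<zeta>: "\<zeta> \<in> primitive_roots n" and "m > 0" "even n" "0 < k" "k < n"
  shows "((\<lambda>x. (-1) ^ k * gauss_binom (x\<^sup>2) (m * n) k * gauss_binom x (2 * (m * n - k)) (n - k) / (1 - x ^ n))
     \<longlongrightarrow> 2 * of_nat m * (2 * of_nat m - 1) * calA_coeff n \<zeta> (n - k)) (at \<zeta>)"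
proof -
  define j where "j = n - k"
  have j: "0 < j" "j < n" "k = n - j" "k + j = n"
    using assms by (auto simp: j_def)
  obtain l where n: "n = 2 * l"
    using \<open>even n\<close> by (elim evenE)
  have "n > 0" "l > 0" using assms n by auto
  have \<eta>: "\<zeta>\<^sup>2 \<in> primitive_roots l"
    using \<zeta> n by (intro square_primitive_root_even) simp
  have sq: "((\<lambda>x. x\<^sup>2) \<longlongrightarrow> \<zeta>\<^sup>2) (at \<zeta>)"
    by (intro tendsto_intros)
  have ev': "\<forall>\<^sub>F x in at \<zeta>. x ^ n \<noteq> 1"
    using eventually_power_neq_1[of n \<zeta>] \<open>n > 0\<close> .
  have pn: "(x\<^sup>2) ^ l = x ^ n" for x :: complex
    by (simp add: n power_mult)
  have ev: "\<forall>\<^sub>F x in at \<zeta>. (x\<^sup>2) ^ l \<noteq> 1"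
    using ev' by (simp only: pn)
  have \<zeta>n: "\<zeta> ^ n = 1"
    using \<zeta> by (simp add: primitive_roots_def)
  have \<zeta>l: "\<zeta> ^ l = - 1"
    using \<zeta> n \<open>l > 0\<close> by (intro primitive_root_even_half) auto
  have ml: "m * n = 2 * m * l"
    by (simp add: n)
  have "m * n - k = (m - 1) * n + j"
    using j \<open>m > 0\<close> by (cases m) auto
  then have N: "2 * (m * n - k) = (2 * (m - 1)) * n + 2 * j"
    by simp
  have lim2: "((\<lambda>x. gauss_binom x (2 * (m * n - k)) (n - k))
      \<longlongrightarrow> (-1) ^ j * \<zeta> ^ (j * (j + 1) + (j choose 2)) * (1 + \<zeta> ^ k) * gauss_binom \<zeta> k j) (at \<zeta>)"
    using tendsto_gauss_binom[OF tendsto_ident_at, of "2 * (m * n - k)" j \<zeta> UNIV]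
      gauss_binom_root_reflection[OF \<zeta> j(1,2), of "2 * (m - 1)"]
    unfolding N j_def[symmetric] using j(3) by simp
  have of_nat_pred: "of_nat (2 * m - 1) = (2 * of_nat m - 1 :: complex)"
    using \<open>m > 0\<close> by (simp add: of_nat_diff)
  consider "k < l" | "k = l" | "k > l" by linarith
  then show ?thesis
  proof cases
    case 1
    have lim1: "((\<lambda>x. gauss_binom (x\<^sup>2) (2 * m * l) k / (1 - (x\<^sup>2) ^ l))
      \<longlongrightarrow> of_nat (2 * m) * (-1) ^ (k - 1) / ((\<zeta>\<^sup>2) ^ (k choose 2) * (1 - (\<zeta>\<^sup>2) ^ k))) (at \<zeta>)"
      using assms 1 by (intro gauss_binom_first_order \<eta> sq ev) auto
    have G0: "gauss_binom \<zeta> k j = 0"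
      using 1 j n by (intro gauss_binom_eq_0) auto
    have "((\<lambda>x. (-1) ^ k * (gauss_binom (x\<^sup>2) (2 * m * l) k / (1 - (x\<^sup>2) ^ l))
           * gauss_binom x (2 * (m * n - k)) (n - k)) \<longlongrightarrow>
         (-1) ^ k * (of_nat (2 * m) * (-1) ^ (k - 1) / ((\<zeta>\<^sup>2) ^ (k choose 2) * (1 - (\<zeta>\<^sup>2) ^ k))) *
         ((-1) ^ j * \<zeta> ^ (j * (j + 1) + (j choose 2)) * (1 + \<zeta> ^ k) * gauss_binom \<zeta> k j)) (at \<zeta>)"
      by (intro tendsto_mult lim1 lim2 tendsto_const)
    then show ?thesis
      unfolding calA_coeff_def j_def[symmetric] j(3)[symmetric] G0 pn ml[symmetric] by simp
  next
    case 2
    have jl: "j = l" using 2 j n by simp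
    have lim1: "((\<lambda>x. gauss_binom (x\<^sup>2) (2 * m * l) l) \<longlongrightarrow> of_nat (2 * m)) (at \<zeta>)"
      using \<open>m > 0\<close> \<open>l > 0\<close> by (intro tendsto_gauss_binom_multiple[OF \<eta> sq ev]) auto
    have lim3: "((\<lambda>x. gauss_binom x ((2 * m - 1) * n) l / (1 - x ^ n))
      \<longlongrightarrow> of_nat (2 * m - 1) * (-1) ^ (l - 1) / (\<zeta> ^ (l choose 2) * (1 - \<zeta> ^ l))) (at \<zeta>)"
      using \<open>m > 0\<close> \<open>l > 0\<close> n by (intro gauss_binom_first_order \<zeta> tendsto_ident_at ev') auto
    have "((\<lambda>x. (-1) ^ k * gauss_binom (x\<^sup>2) (2 * m * l) l * (gauss_binom x ((2 * m - 1) * n) l / (1 - x ^ n)))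
        \<longlongrightarrow> (-1) ^ k * of_nat (2 * m) * (of_nat (2 * m - 1) * (-1) ^ (l - 1) / (\<zeta> ^ (l choose 2) * (1 - \<zeta> ^ l)))) (at \<zeta>)"
      by (intro tendsto_mult lim1 lim3 tendsto_const)
    also have "(-1) ^ k * of_nat (2 * m) * (of_nat (2 * m - 1) * (-1) ^ (l - 1) / (\<zeta> ^ (l choose 2) * (1 - \<zeta> ^ l)))
       = 2 * of_nat m * (2 * of_nat m - 1) * calA_coeff n \<zeta> (n - k)"
    proof -
      let ?z = "\<zeta> ^ (l choose 2)"
      have s: "(-1) ^ l * (-1) ^ (l - 1) = (- 1 :: complex)"
        using \<open>0 < l\<close> by (cases l) (auto simp flip: power_add)
      have "?z * ?z = \<zeta> ^ (l * (l - 1))"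
        by (simp add: two_choose_2 flip: power_add mult_2)
      also have "\<dots> = (-1) ^ (l - 1)"
        by (simp add: power_mult \<zeta>l)
      finally have zz: "(-1) ^ (l - 1) = ?z * ?z" by simp
      have z: "?z \<noteq> 0"
        using primitive_roots_nonzero[OF \<zeta> \<open>n > 0\<close>] by simp
      have "(-1) ^ l * (-1) ^ (l - 1) / ?z = (-1) ^ l * ?z"
        using z by (simp only: zz) simp
      moreover have "(-1) ^ k * of_nat (2 * m) * (of_nat (2 * m - 1) * (-1) ^ (l - 1) / (?z * (1 - \<zeta> ^ l)))
          = of_nat m * (2 * of_nat m - 1) * ((-1) ^ l * (-1) ^ (l - 1) / ?z)"
        unfolding of_nat_pred \<zeta>l 2 by simp
      moreover have "calA_coeff n \<zeta> (n - k) = (-1) ^ l * ?z / 2"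
        using n by (simp add: calA_coeff_def 2 \<zeta>l)
      ultimately show ?thesis
        by (simp only:) simp
    qed
    finally show ?thesis
    proof (rule Lim_transform_eventually)
      have "m * n - l = (m - 1) * n + l"
        using n \<open>m > 0\<close> by (cases m) auto
      then have "2 * (m * n - l) = (2 * m - 1) * n"
        using n \<open>m > 0\<close> by (cases m) (auto simp: algebra_simps)
      moreover have "n - l = l" using n by simp
      ultimately show "\<forall>\<^sub>F x in at \<zeta>. (-1) ^ k * gauss_binom (x\<^sup>2) (2 * m * l) l
           * (gauss_binom x ((2 * m - 1) * n) l / (1 - x ^ n))
         = (-1) ^ k * gauss_binom (x\<^sup>2) (m * n) k * gauss_binom x (2 * (m * n - k)) (n - k) / (1 - x ^ n)"
        unfolding 2 ml[symmetric] by simp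
    qed
  next
    case 3
    define s where "s = k - l"
    have s: "0 < s" "s < l" "k = l + s" "l = s + j"
      using 3 j n by (auto simp: s_def)
    have lim1: "((\<lambda>x. gauss_binom (x\<^sup>2) (2 * m * l) (l + s) / (1 - (x\<^sup>2) ^ l))
      \<longlongrightarrow> of_nat (2 * m) * (of_nat (2 * m - 1) * (-1) ^ (s - 1) / ((\<zeta>\<^sup>2) ^ (s choose 2) * (1 - (\<zeta>\<^sup>2) ^ s)))) (at \<zeta>)"
      using \<open>m > 0\<close> s by (intro gauss_binom_first_order_above \<eta> sq ev) auto
    have "((\<lambda>x. (-1) ^ k * (gauss_binom (x\<^sup>2) (2 * m * l) (l + s) / (1 - (x\<^sup>2) ^ l))
           * gauss_binom x (2 * (m * n - k)) (n - k)) \<longlongrightarrow>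
         (-1) ^ k * (of_nat (2 * m) * (of_nat (2 * m - 1) * (-1) ^ (s - 1) / ((\<zeta>\<^sup>2) ^ (s choose 2) * (1 - (\<zeta>\<^sup>2) ^ s)))) *
         ((-1) ^ j * \<zeta> ^ (j * (j + 1) + (j choose 2)) * (1 + \<zeta> ^ k) * gauss_binom \<zeta> k j)) (at \<zeta>)"
      by (intro tendsto_mult lim1 lim2 tendsto_const)
    also have "(-1) ^ k * (of_nat (2 * m) * (of_nat (2 * m - 1) * (-1) ^ (s - 1) / ((\<zeta>\<^sup>2) ^ (s choose 2) * (1 - (\<zeta>\<^sup>2) ^ s)))) *
         ((-1) ^ j * \<zeta> ^ (j * (j + 1) + (j choose 2)) * (1 + \<zeta> ^ k) * gauss_binom \<zeta> k j)
       = 2 * of_nat m * (2 * of_nat m - 1) * calA_coeff n \<zeta> (n - k)"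
    proof -
      \<comment> \<open>From \<open>l = s + j\<close>, the two exponents agree modulo
        \<open>l\<close>; as \<open>\<zeta> ^ l = -1\<close>, the added multiples of
        \<open>l\<close> leave the sign \<open>- ((-1) ^ l)\<close>.\<close>
      have "s * (s - 1) + l * (2 * j + 1) = l * l + j * (j + 1)"
        unfolding s(4) using \<open>0 < s\<close> by (cases s) (auto simp: algebra_simps)
      then have "\<zeta> ^ (s * (s - 1)) * \<zeta> ^ (l * (2 * j + 1)) = \<zeta> ^ (l * l) * \<zeta> ^ (j * (j + 1))"
        by (simp only: flip: power_add)
      then have "\<zeta> ^ (s * (s - 1)) = - ((-1) ^ l * \<zeta> ^ (j * (j + 1)))"
        unfolding power_mult[of \<zeta> l] \<zeta>l by simp (metis minus_minus)
      then have e1: "(\<zeta>\<^sup>2) ^ (s choose 2) = - ((-1) ^ l * \<zeta> ^ (j * (j + 1)))"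
        by (simp add: power_mult[symmetric] two_choose_2)
      have "(\<zeta>\<^sup>2) ^ k = (\<zeta>\<^sup>2) ^ s"
        unfolding s(3) power_add pn \<zeta>n by simp
      then have e2: "1 - (\<zeta>\<^sup>2) ^ s = (1 - \<zeta> ^ k) * (1 + \<zeta> ^ k)"
        by (metis one_minus_square_power)
      have "1 - (\<zeta>\<^sup>2) ^ s \<noteq> 0"
        using \<eta> s by (auto simp: primitive_roots_def)
      then have nz: "1 - \<zeta> ^ k \<noteq> 0" "1 + \<zeta> ^ k \<noteq> 0"
        unfolding e2 by auto
      have z: "\<zeta> ^ (j * (j + 1)) \<noteq> 0"
        using primitive_roots_nonzero[OF \<zeta> \<open>n > 0\<close>] by simp
      have sgn: "(-1) ^ k * (-1) ^ (s - 1) = - ((-1) ^ l :: complex)"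
      proof -
        obtain s' where "s = Suc s'" using s(1) by (cases s) auto
        then show ?thesis by (simp add: s(3) power_add flip: power_mult_distrib)
      qed
      have key: "s1 * (M * (M' * s2 / (- (L * Z) * (U * V)))) * (S * (Z * C) * V * G)
          = M * M' * (S * C * G / U)"
        if "Z \<noteq> 0" "V \<noteq> 0" "L \<noteq> 0" "s1 * s2 = - L" for s1 s2 M M' Z U V S C G L :: complex
      proof -
        have "s1 * (M * (M' * s2 / (- (L * Z) * (U * V)))) * (S * (Z * C) * V * G)
           = (s1 * s2) * (M * M' * (S * C * G / U)) / (- L)"
          using that(1,2,3) by (simp add: divide_simps)
        then show ?thesis using that by simp
      qed
      have "(-1) ^ l \<noteq> (0 :: complex)"
        by simp
      note key = key[OF z nz(2) this sgn]
      show ?thesis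
        unfolding calA_coeff_def e1 e2 j_def[symmetric] j(3)[symmetric] power_add[of \<zeta> "j * (j + 1)"] of_nat_pred key
        by simp
    qed
    finally show ?thesis
      unfolding pn s(3)[symmetric] ml[symmetric] by simp
  qed
qed

text \<open>The difference of the two sides of the congruence, with the surviving part of
  \<open>T0\<close> in Gaussian binomials. Being polymorphic, it can be read in
  \<open>int poly\<close>, in its fraction field and over the complex numbers.\<close>

definition defect :: "nat \<Rightarrow> nat \<Rightarrow> 'a::comm_ring_1 \<Rightarrow> 'a" where
  "defect m n q =
     (\<Sum>k\<le>n. (-1) ^ k * gauss_binom (q\<^sup>2) (m * n) k * gauss_binom q (2 * (m * n - k)) (n - k))
     - (2 * of_nat m - of_nat n * of_nat m * (2 * of_nat m - 1) * (1 - q ^ n)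
      + (-1) ^ n * ((1 + (-1) ^ n) * (of_nat m - 1) + 1)
        * (of_nat m - of_nat n * of_nat m * (of_nat m - 1) * (1 - q ^ n)
           + 2 * of_nat m * (calA_ring n q - 1)))"

text \<open>\<open>W\<close> is 1 for odd \<open>n\<close> and \<open>2 * m - 1\<close> for even
  \<open>n\<close>. In the odd case one period of \<open>\<zeta>\<^sup>2\<close> is involved and the
  factor \<open>1 + x ^ n\<close> cancels the one half; in the even case two periods are
  involved.\<close>

lemma last_term_limit:
  assumes \<zeta>: "\<zeta> \<in> primitive_roots n" and "m > 0" "n > 0"
  defines "W \<equiv> (1 + (-1) ^ n) * (of_nat m - 1) + 1"
  shows "((\<lambda>x. (gauss_binom (x\<^sup>2) (m * n) n - W * of_nat m) / (1 - x ^ n))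
           \<longlongrightarrow> - (W * (of_nat n * of_nat m * (of_nat m - 1)))) (at \<zeta>)"
proof -
  have sq: "((\<lambda>x. x\<^sup>2) \<longlongrightarrow> \<zeta>\<^sup>2) (at \<zeta>)"
    by (intro tendsto_intros)
  show ?thesis
  proof (cases "even n")
    case False
    then have \<eta>: "\<zeta>\<^sup>2 \<in> primitive_roots n"
      using \<zeta> by (intro square_primitive_root_odd)
    have ev: "\<forall>\<^sub>F x in at \<zeta>. (x\<^sup>2) ^ n \<noteq> 1"
      using eventually_power_neq_1[of "2 * n" \<zeta>] \<open>n > 0\<close> by (simp add: power_mult)
    have W: "W = 1" using False by (simp add: W_def)
    have "((\<lambda>x. (gauss_binom (x\<^sup>2) (m * n) n - of_nat m) / (1 - (x\<^sup>2) ^ n) * (1 + x ^ n))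
       \<longlongrightarrow> - (of_nat n * of_nat m * (of_nat m - 1) / 2) * (1 + \<zeta> ^ n)) (at \<zeta>)"
      using assms by (intro tendsto_intros gauss_binom_second_order[OF \<eta> sq ev])
    then have "((\<lambda>x. (gauss_binom (x\<^sup>2) (m * n) n - of_nat m) / (1 - (x\<^sup>2) ^ n) * (1 + x ^ n))
       \<longlongrightarrow> - (W * (of_nat n * of_nat m * (of_nat m - 1)))) (at \<zeta>)"
      using \<zeta> by (simp add: W primitive_roots_def)
    then show ?thesis
    proof (rule Lim_transform_eventually)
      show "\<forall>\<^sub>F x in at \<zeta>. (gauss_binom (x\<^sup>2) (m * n) n - of_nat m) / (1 - (x\<^sup>2) ^ n) * (1 + x ^ n)
         = (gauss_binom (x\<^sup>2) (m * n) n - W * of_nat m) / (1 - x ^ n)"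
        using ev
      proof eventually_elim
        case (elim x)
        have 2: "1 - (x\<^sup>2) ^ n = (1 - x ^ n) * (1 + x ^ n)"
          by (rule one_minus_square_power)
        then have "1 + x ^ n \<noteq> 0"
          using elim by auto
        then show ?case
          unfolding 2 by (simp add: W)
      qed
    qed
  next
    case True
    then obtain l where n: "n = 2 * l" by (elim evenE)
    have W: "W = 2 * of_nat m - 1" using True by (simp add: W_def algebra_simps)
    have \<eta>: "\<zeta>\<^sup>2 \<in> primitive_roots l"
      using \<zeta> n by (intro square_primitive_root_even) simp
    have pn: "(x\<^sup>2) ^ l = x ^ n" for x :: complex
      by (simp add: n power_mult)
    have ev: "\<forall>\<^sub>F x in at \<zeta>. (x\<^sup>2) ^ l \<noteq> 1"
      using eventually_power_neq_1[of n \<zeta>] \<open>n > 0\<close> by (simp only: pn)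
    have ml: "2 * m * l = m * n" by (simp add: n)
    show ?thesis
      using gauss_binom_second_order_double[OF \<eta> sq ev \<open>m > 0\<close>] \<open>n > 0\<close>
      unfolding W pn ml by (simp add: n)
  qed
qed

text \<open>The first-order terms of the summands \<open>k = 0\<close> and \<open>k = n\<close>
  match the explicit terms in \<open>1 - x ^ n\<close>, and the middle summands match the term in
  \<open>calA_ring n x - 1\<close>.\<close>

lemma defect_limit:
  assumes \<zeta>: "\<zeta> \<in> primitive_roots n" and "m > 0" "n > 0"
  shows "((\<lambda>x. defect m n x / (1 - x ^ n)) \<longlongrightarrow> 0) (at \<zeta>)"
proof -
  define W :: complex where "W = (1 + (-1) ^ n) * (of_nat m - 1) + 1"
  define t where "t k x = (-1) ^ k * gauss_binom (x\<^sup>2) (m * n) k * gauss_binom x (2 * (m * n - k)) (n - k)"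
    for k and x :: complex
  define L where "L = (\<Sum>j=1..<n. calA_coeff n \<zeta> j)"
  have ev: "\<forall>\<^sub>F x in at \<zeta>. x ^ n \<noteq> 1"
    using eventually_power_neq_1[of n \<zeta>] \<open>n > 0\<close> .
  \<comment> \<open>Both parities take a common form, because \<open>(-1) ^ n * W\<close> is
    \<open>-1\<close> for odd \<open>n\<close> and \<open>2 * m - 1\<close> for even
    \<open>n\<close>.\<close>
  have mid: "((\<lambda>x. t k x / (1 - x ^ n)) \<longlongrightarrow> (-1) ^ n * W * (2 * of_nat m) * calA_coeff n \<zeta> (n - k)) (at \<zeta>)"
    if "k \<in> {1..<n}" for k
  proof (cases "even n")
    case True
    then show ?thesis
      using middle_term_even[OF \<zeta> \<open>m > 0\<close> True, of k] that
      by (simp add: t_def W_def algebra_simps)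
  next
    case False
    then show ?thesis
      using middle_term_odd[OF \<zeta> \<open>m > 0\<close> False, of k] that
      by (simp add: t_def W_def)
  qed
  have "((\<lambda>x. \<Sum>k=1..<n. t k x / (1 - x ^ n))
      \<longlongrightarrow> (\<Sum>k=1..<n. (-1) ^ n * W * (2 * of_nat m) * calA_coeff n \<zeta> (n - k))) (at \<zeta>)"
    by (intro tendsto_sum mid)
  moreover have "(\<Sum>k=1..<n. calA_coeff n \<zeta> (n - k)) = L"
    unfolding L_def by (rule sum.reindex_bij_witness[of _ "\<lambda>k. n - k" "\<lambda>k. n - k"]) auto
  ultimately have mids: "((\<lambda>x. (\<Sum>k=1..<n. t k x) / (1 - x ^ n)) \<longlongrightarrow> (-1) ^ n * W * (2 * of_nat m) * L) (at \<zeta>)"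
    by (simp add: sum_divide_distrib sum_distrib_left[symmetric])
  have A: "((\<lambda>x. (calA_ring n x - 1) / (1 - x ^ n)) \<longlongrightarrow> L) (at \<zeta>)"
    unfolding L_def by (rule tendsto_calA_ring) fact+
  have last: "((\<lambda>x. (gauss_binom (x\<^sup>2) (m * n) n - W * of_nat m) / (1 - x ^ n))
       \<longlongrightarrow> - (W * (of_nat n * of_nat m * (of_nat m - 1)))) (at \<zeta>)"
    unfolding W_def by (rule last_term_limit) fact+
  have first: "((\<lambda>x. (gauss_binom x (2 * m * n) n - 2 * of_nat m) / (1 - x ^ n))
       \<longlongrightarrow> - (of_nat n * of_nat m * (2 * of_nat m - 1))) (at \<zeta>)"
    using gauss_binom_second_order[OF \<zeta> tendsto_ident_at ev, of "2 * m"] assms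
    by (simp add: mult.assoc)
  have "((\<lambda>x. (gauss_binom x (2 * m * n) n - 2 * of_nat m) / (1 - x ^ n)
        + (\<Sum>k=1..<n. t k x) / (1 - x ^ n)
        + (-1) ^ n * ((gauss_binom (x\<^sup>2) (m * n) n - W * of_nat m) / (1 - x ^ n))
        + of_nat n * of_nat m * (2 * of_nat m - 1)
        + (-1) ^ n * W * (of_nat n * of_nat m * (of_nat m - 1))
        - (-1) ^ n * W * (2 * of_nat m) * ((calA_ring n x - 1) / (1 - x ^ n)))
     \<longlongrightarrow> - (of_nat n * of_nat m * (2 * of_nat m - 1)) + (-1) ^ n * W * (2 * of_nat m) * L
        + (-1) ^ n * (- (W * (of_nat n * of_nat m * (of_nat m - 1))))
        + of_nat n * of_nat m * (2 * of_nat m - 1)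
        + (-1) ^ n * W * (of_nat n * of_nat m * (of_nat m - 1))
        - (-1) ^ n * W * (2 * of_nat m) * L) (at \<zeta>)"
    by (intro tendsto_intros first mids last A)
  also have "- (of_nat n * of_nat m * (2 * of_nat m - 1)) + (-1) ^ n * W * (2 * of_nat m) * L
        + (-1) ^ n * (- (W * (of_nat n * of_nat m * (of_nat m - 1))))
        + of_nat n * of_nat m * (2 * of_nat m - 1)
        + (-1) ^ n * W * (of_nat n * of_nat m * (of_nat m - 1))
        - (-1) ^ n * W * (2 * of_nat m) * L = 0"
    by (simp add: algebra_simps)
  finally show ?thesis
  proof (rule Lim_transform_eventually)
    show "\<forall>\<^sub>F x in at \<zeta>. (gauss_binom x (2 * m * n) n - 2 * of_nat m) / (1 - x ^ n)
        + (\<Sum>k=1..<n. t k x) / (1 - x ^ n)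
        + (-1) ^ n * ((gauss_binom (x\<^sup>2) (m * n) n - W * of_nat m) / (1 - x ^ n))
        + of_nat n * of_nat m * (2 * of_nat m - 1)
        + (-1) ^ n * W * (of_nat n * of_nat m * (of_nat m - 1))
        - (-1) ^ n * W * (2 * of_nat m) * ((calA_ring n x - 1) / (1 - x ^ n))
      = defect m n x / (1 - x ^ n)"
      using ev
    proof eventually_elim
      case (elim x)
      have "{..n} = insert 0 (insert n {1..<n})" using \<open>n > 0\<close> by auto
      then have "(\<Sum>k\<le>n. t k x) = t 0 x + t n x + (\<Sum>k=1..<n. t k x)"
        using \<open>n > 0\<close> by simp
      also have "t 0 x = gauss_binom x (2 * m * n) n"
        by (simp add: t_def mult.assoc)
      also have "t n x = (-1) ^ n * gauss_binom (x\<^sup>2) (m * n) n"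
        by (simp add: t_def)
      finally have sum: "(\<Sum>k\<le>n. t k x)
        = gauss_binom x (2 * m * n) n + (-1) ^ n * gauss_binom (x\<^sup>2) (m * n) n + (\<Sum>k=1..<n. t k x)" .
      have "(g - 2 * M) / u + S / u + s * ((h - W * M) / u) + N * M * (2 * M - 1)
           + s * W * (N * M * (M - 1)) - s * W * (2 * M) * (a / u)
         = (g + s * h + S - (2 * M - N * M * (2 * M - 1) * u
            + s * W * (M - N * M * (M - 1) * u + 2 * M * a))) / u"
        if "u \<noteq> 0" for g M u S s h N a :: complex
        using that by (simp add: divide_simps) (simp add: algebra_simps)
      from this[of "1 - x ^ n"] elim show ?case
        unfolding defect_def t_def[symmetric] sum W_def[symmetric] by simp
    qed
  qed
qed

section \<open>Divisibility by the square of a cyclotomic polynomial\<close>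

text \<open>\<open>defect\<close> uses ring operations only, so it commutes with the two maps
  needed: the embedding into rational functions and evaluation at a complex number.\<close>

locale ring_1_hom =
  fixes h :: "'a::comm_ring_1 \<Rightarrow> 'b::comm_ring_1"
  assumes hom_add: "h (x + y) = h x + h y"
    and hom_mult: "h (x * y) = h x * h y"
    and hom_1: "h 1 = 1"
begin

lemma hom_0: "h 0 = 0"
  using hom_add[of 0 0] by simp

lemma hom_uminus: "h (- x) = - h x"
  using hom_add[of x "- x"] by (simp add: hom_0 add_eq_0_iff)

lemma hom_diff: "h (x - y) = h x - h y"
  using hom_add[of x "- y"] by (simp add: hom_uminus)

lemma hom_power: "h (x ^ n) = h x ^ n"
  by (induction n) (simp_all add: hom_1 hom_mult)

lemma hom_of_nat: "h (of_nat n) = of_nat n"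
  by (induction n) (simp_all add: hom_0 hom_1 hom_add)

lemma hom_2: "h 2 = 2"
  using hom_of_nat[of 2] by simp

lemma hom_sum: "h (sum f A) = (\<Sum>x\<in>A. h (f x))"
  by (induction A rule: infinite_finite_induct) (simp_all add: hom_0 hom_add)

lemma hom_gauss_binom: "h (gauss_binom q n k) = gauss_binom (h q) n k"
  by (induction q n k rule: gauss_binom.induct)
     (simp_all add: hom_0 hom_1 hom_add hom_mult hom_power)

lemma hom_calA_ring: "h (calA_ring n q) = calA_ring n (h q)"
  by (simp add: calA_ring_def Let_def hom_mult hom_power hom_uminus hom_1 hom_add)

lemma hom_defect: "h (defect m n q) = defect m n (h q)"
  unfolding defect_def
  by (simp only: hom_add hom_diff hom_mult hom_power hom_uminus hom_1 hom_2 hom_of_nat hom_sum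
      hom_gauss_binom hom_calA_ring)

end

interpretation to_fract: ring_1_hom "to_fract :: int poly \<Rightarrow> int poly fract"
  by unfold_locales simp_all

lemma ring_1_hom_eval: "ring_1_hom (\<lambda>p. poly (map_poly of_int p) (x :: complex))"
  by unfold_locales (simp_all add: of_int_poly_add of_int_poly_mult)

text \<open>For monic \<open>P\<close> pseudo-division is division with remainder. Over the complex
  numbers \<open>P\<close> divides the remainder, which is too small in degree to be
  nonzero.\<close>

lemma int_poly_dvd_of_complex_dvd:
  assumes "lead_coeff P = 1"
    and "map_poly (of_int :: int \<Rightarrow> complex) P dvd map_poly of_int D"
  shows "P dvd D"
proof -
  let ?c = "map_poly (of_int :: int \<Rightarrow> complex)"
  have nz: "P \<noteq> 0" using assms(1) by auto
  obtain q r where qr: "pseudo_divmod D P = (q, r)" by fastforce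
  have eq: "D = P * q + r" and r: "r = 0 \<or> degree r < degree P"
    using pseudo_divmod[OF nz qr] by (simp_all add: assms(1))
  have "?c P dvd ?c P * ?c q + ?c r"
    using assms(2) unfolding eq by (simp add: of_int_poly_add of_int_poly_mult)
  then have dvd: "?c P dvd ?c r"
    by (simp add: dvd_add_right_iff)
  have "r = 0"
  proof (rule ccontr)
    assume "r \<noteq> 0"
    then have "?c r \<noteq> 0"
      by (metis map_poly_eq_0_iff of_int_0 of_int_eq_0_iff)
    then have "degree (?c P) \<le> degree (?c r)"
      using dvd by (rule dvd_imp_degree_le[rotated])
    then show False
      using r \<open>r \<noteq> 0\<close> by (simp add: degree_map_poly)
  qed
  then show ?thesis
    using eq by simp
qed

text \<open>The product over the other points does not vanish at \<open>z\<close>, so the cofactor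
  \<open>E\<close> inherits the full order of \<open>D\<close> at \<open>z\<close>.\<close>

lemma prod_linear_squares_dvd:
  fixes D :: "complex poly"
  assumes "finite A" "\<And>z. z \<in> A \<Longrightarrow> [:- z, 1:]\<^sup>2 dvd D"
  shows "(\<Prod>z\<in>A. [:- z, 1:])\<^sup>2 dvd D"
proof (cases "D = 0")
  case False
  show ?thesis
    using assms
  proof (induction A)
    case (insert z A)
    let ?P = "(\<Prod>z\<in>A. [:- z, 1:])\<^sup>2"
    obtain E where E: "D = ?P * E"
      using insert by (meson dvdE insertI2)
    have "poly ?P z \<noteq> 0"
      using insert.hyps by (auto simp: poly_prod)
    then have "order z ?P = 0"
      by (rule order_0I)
    then have "order z D = order z E"
      using False order_mult[of ?P E z] by (simp add: E)
    moreover have "2 \<le> order z D"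
      using insert.prems[of z] False by (simp add: order_divides)
    ultimately have "[:- z, 1:]\<^sup>2 dvd E"
      by (simp only: order_divides) simp
    then have "[:- z, 1:]\<^sup>2 * ?P dvd D"
      unfolding E mult.commute[of ?P] by (rule mult_dvd_mono) simp
    then show ?case
      using insert.hyps by (simp only: prod.insert power_mult_distrib not_False_eq_True)
  qed simp
qed simp

text \<open>The limit forces a first root, \<open>D = (x - \<zeta>) * E\<close>. With
  \<open>1 - x ^ n = (x - \<zeta>) * S\<close>, the given quotient times \<open>S\<close> is
  \<open>E\<close>, so \<open>E\<close> vanishes at \<open>\<zeta>\<close> as well.\<close>

lemma double_root_of_limit:
  fixes D :: "complex poly"
  assumes "\<zeta> ^ n = 1" "n > 0"
    and lim: "((\<lambda>x. poly D x / (1 - x ^ n)) \<longlongrightarrow> 0) (at \<zeta>)"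
  shows "[:- \<zeta>, 1:]\<^sup>2 dvd D"
proof -
  have ev: "\<forall>\<^sub>F x in at \<zeta>. x ^ n \<noteq> 1"
    using eventually_power_neq_1 \<open>n > 0\<close> .
  have D: "(poly D \<longlongrightarrow> poly D \<zeta>) (at \<zeta>)"
    by (rule tendsto_poly[OF tendsto_ident_at])
  have "((\<lambda>x. poly D x / (1 - x ^ n) * (1 - x ^ n)) \<longlongrightarrow> 0 * (1 - \<zeta> ^ n)) (at \<zeta>)"
    by (intro tendsto_intros lim)
  then have "((\<lambda>x. poly D x / (1 - x ^ n) * (1 - x ^ n)) \<longlongrightarrow> 0) (at \<zeta>)"
    by simp
  then have "(poly D \<longlongrightarrow> 0) (at \<zeta>)"
    by (rule Lim_transform_eventually) (use ev in eventually_elim, simp)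
  then have "poly D \<zeta> = 0"
    using D by (intro tendsto_unique[of "at \<zeta>"]) auto
  then obtain E where E: "D = [:- \<zeta>, 1:] * E"
    unfolding poly_eq_0_iff_dvd by (elim dvdE)
  have "poly (1 - monom 1 n) \<zeta> = 0"
    using assms by (simp add: poly_monom)
  then obtain S where S: "1 - monom 1 n = [:- \<zeta>, 1:] * S"
    unfolding poly_eq_0_iff_dvd by (elim dvdE)
  have S': "1 - x ^ n = (x - \<zeta>) * poly S x" for x
    using arg_cong[OF S, of "\<lambda>p. poly p x"] by (simp add: poly_monom algebra_simps)
  have "((\<lambda>x. poly D x / (1 - x ^ n) * poly S x) \<longlongrightarrow> 0 * poly S \<zeta>) (at \<zeta>)"
    by (intro tendsto_mult lim tendsto_poly[OF tendsto_ident_at])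
  then have "((\<lambda>x. poly D x / (1 - x ^ n) * poly S x) \<longlongrightarrow> 0) (at \<zeta>)"
    by simp
  then have "(poly E \<longlongrightarrow> 0) (at \<zeta>)"
  proof (rule Lim_transform_eventually)
    show "\<forall>\<^sub>F x in at \<zeta>. poly D x / (1 - x ^ n) * poly S x = poly E x"
      using ev
    proof eventually_elim
      case (elim x)
      have "poly D x = (x - \<zeta>) * poly E x"
        by (simp add: E algebra_simps)
      moreover have "x - \<zeta> \<noteq> 0" "poly S x \<noteq> 0"
        using elim S'[of x] by auto
      ultimately show ?case
        by (simp add: S')
    qed
  qed
  moreover have "(poly E \<longlongrightarrow> poly E \<zeta>) (at \<zeta>)"
    by (rule tendsto_poly[OF tendsto_ident_at])
  ultimately have "poly E \<zeta> = 0"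
    by (intro tendsto_unique[of "at \<zeta>"]) auto
  then have "[:- \<zeta>, 1:] dvd E"
    by (simp add: poly_eq_0_iff_dvd)
  then show ?thesis
    unfolding E power2_eq_square by (rule mult_dvd_mono[OF dvd_refl])
qed

lemma cyclotomic_square_dvd:
  fixes D :: "int poly"
  assumes "n > 0"
    and "\<And>\<zeta>. \<zeta> \<in> primitive_roots n \<Longrightarrow>
          ((\<lambda>x. poly (map_poly of_int D) x / (1 - x ^ n)) \<longlongrightarrow> 0) (at \<zeta>)"
  shows "(cyclotomic n)\<^sup>2 dvd D"
proof (rule int_poly_dvd_of_complex_dvd)
  let ?c = "map_poly (of_int :: int \<Rightarrow> complex)"
  have sq: "?c ((cyclotomic n)\<^sup>2) = (\<Prod>z\<in>primitive_roots n. [:- z, 1:])\<^sup>2"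
    by (simp add: power2_eq_square of_int_poly_mult of_int_cyclotomic[OF assms(1)])
  have "lead_coeff (?c ((cyclotomic n)\<^sup>2)) = 1"
    unfolding sq by (simp add: lead_coeff_power lead_coeff_prod)
  then have "of_int (lead_coeff ((cyclotomic n)\<^sup>2)) = (1 :: complex)"
    by (simp add: degree_map_poly coeff_map_poly)
  then show "lead_coeff ((cyclotomic n)\<^sup>2) = 1"
    by (metis of_int_eq_1_iff)
  show "?c ((cyclotomic n)\<^sup>2) dvd ?c D"
    unfolding sq
  proof (rule prod_linear_squares_dvd)
    fix z assume "z \<in> primitive_roots n"
    then show "[:- z, 1:]\<^sup>2 dvd ?c D"
      using assms by (intro double_root_of_limit[of z n]) (auto simp: primitive_roots_def)
  qed (use finite_primitive_roots assms in auto)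
qed

section \<open>From q-trinomial coefficients to Gaussian binomials\<close>

lemma qbinom_eq_gauss_binom:
  fixes q :: "'a::field"
  assumes "\<And>i. i > 0 \<Longrightarrow> q ^ i \<noteq> 1"
  shows "qbinom q (int N) (int k) = gauss_binom q N k"
proof (cases "k \<le> N")
  case True
  have "(\<Prod>i=1..k. 1 - q ^ i) \<noteq> 0"
    using assms by (auto simp: prod_zero_iff)
  then show ?thesis
    using True gauss_binom_prod[of q N k] by (simp add: qbinom_def nonzero_divide_eq_eq)
qed (simp add: qbinom_def gauss_binom_eq_0)

text \<open>The second lower index is \<open>n - k\<close>, so \<open>qbinom\<close> is 0 by
  definition for \<open>k > n\<close>. The assumption on \<open>q\<close> keeps all denominators
  nonzero, for \<open>q\<close> and for its square.\<close>

lemma T0_eq_sum_gauss_binom: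
  fixes q :: "'a::field"
  assumes "m > 0" and q: "\<And>i. i > 0 \<Longrightarrow> q ^ i \<noteq> 1"
  shows "T0 (int m * int n) ((int m - 1) * int n) q =
    (\<Sum>k\<le>n. (-1) ^ k * gauss_binom (q\<^sup>2) (m * n) k * gauss_binom q (2 * (m * n - k)) (n - k))"
proof -
  let ?f = "\<lambda>k. (-1) ^ nat k * qbinom (q\<^sup>2) (int m * int n) k
      * qbinom q (2 * (int m * int n) - 2 * k) (int m * int n - (int m - 1) * int n - k)"
  have nm: "n \<le> m * n" using assms(1) by simp
  have e: "int m * int n - (int m - 1) * int n = int n"
    by (simp add: algebra_simps)
  have "T0 (int m * int n) ((int m - 1) * int n) q = (\<Sum>k=0..int m * int n. ?f k)"
    unfolding T0_def ..
  also have "\<dots> = (\<Sum>k=0..int n. ?f k)"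
  proof (rule sum.mono_neutral_right)
    show "{0..int n} \<subseteq> {0..int m * int n}"
      using nm by (auto simp flip: of_nat_mult)
    show "\<forall>k\<in>{0..int m * int n} - {0..int n}. ?f k = 0"
      unfolding e by (auto simp: qbinom_def)
  qed simp
  also have "\<dots> = (\<Sum>k\<le>n. ?f (int k))"
    by (rule sum.reindex_bij_witness[of _ int nat]) auto
  also have "\<dots> = (\<Sum>k\<le>n. (-1) ^ k * gauss_binom (q\<^sup>2) (m * n) k * gauss_binom q (2 * (m * n - k)) (n - k))"
  proof (intro sum.cong refl)
    fix k assume "k \<in> {..n}"
    then have k: "k \<le> n" by simp
    then have "k \<le> m * n" using nm by (rule order_trans)
    have q2: "(q\<^sup>2) ^ i \<noteq> 1" if "i > 0" for i
      using q[of "2 * i"] that by (simp add: power_mult)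
    have "2 * (int m * int n) - 2 * int k = int (2 * (m * n - k))" "int n - int k = int (n - k)"
      using k \<open>k \<le> m * n\<close> by (simp_all add: of_nat_diff)
    then show "?f (int k) = (-1) ^ k * gauss_binom (q\<^sup>2) (m * n) k * gauss_binom q (2 * (m * n - k)) (n - k)"
      unfolding e by (simp only: nat_int of_nat_mult[symmetric] qbinom_eq_gauss_binom[OF q] qbinom_eq_gauss_binom[OF q2])
  qed
  finally show ?thesis .
qed

lemma qvar_power_neq_1: "i > 0 \<Longrightarrow> qvar ^ i \<noteq> 1"
proof
  assume i: "i > 0" and "qvar ^ i = 1"
  then have "to_fract ([:0, 1:] ^ i) = to_fract (1 :: int poly)"
    by (simp add: qvar_def to_fract.hom_power)
  then have "[:0, 1:] ^ i = (1 :: int poly)"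
    by (simp only: to_fract_eq_iff)
  then have "degree ([:0, 1:] ^ i :: int poly) = 0"
    by simp
  then show False
    using i by (simp add: degree_power_eq)
qed

theorem theorem1p2:
  fixes m n :: nat
  assumes "m > 0" and "n > 0"
  shows "ratfun_cong
    (T0 (int m * int n) ((int m - 1) * int n) qvar)
    (2 * of_nat m - of_nat n * of_nat m * (2 * of_nat m - 1) * (1 - qvar ^ n)
      + (-1) ^ n * ((1 + (-1) ^ n) * (of_nat m - 1) + 1)
        * (of_nat m - of_nat n * of_nat m * (of_nat m - 1) * (1 - qvar ^ n)
           + 2 * of_nat m * (calA n qvar - 1)))
    (cyclotomic n ^ 2)"
proof -
  let ?D = "defect m n [:0, 1:] :: int poly"
  have "(cyclotomic n)\<^sup>2 dvd ?D"
  proof (rule cyclotomic_square_dvd[OF \<open>n > 0\<close>])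
    fix \<zeta> assume \<zeta>: "\<zeta> \<in> primitive_roots n"
    have "poly (map_poly of_int ?D) x = defect m n x" for x :: complex
      using ring_1_hom.hom_defect[OF ring_1_hom_eval[of x], of m n "[:0, 1:]"]
      by (simp add: map_poly_pCons)
    then show "((\<lambda>x. poly (map_poly of_int ?D) x / (1 - x ^ n)) \<longlongrightarrow> 0) (at \<zeta>)"
      using defect_limit[OF \<zeta> assms] by simp
  qed
  moreover have hom: "to_fract ?D = defect m n qvar"
    unfolding qvar_def by (rule to_fract.hom_defect)
  have "calA n qvar = calA_ring n qvar"
    unfolding calA_def calA_ring_def ..
  then have "T0 (int m * int n) ((int m - 1) * int n) qvar
    - (2 * of_nat m - of_nat n * of_nat m * (2 * of_nat m - 1) * (1 - qvar ^ n)
      + (-1) ^ n * ((1 + (-1) ^ n) * (of_nat m - 1) + 1)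
        * (of_nat m - of_nat n * of_nat m * (of_nat m - 1) * (1 - qvar ^ n)
           + 2 * of_nat m * (calA n qvar - 1))) = to_fract ?D"
    unfolding hom unfolding defect_def
    by (simp only: T0_eq_sum_gauss_binom[OF \<open>m > 0\<close> qvar_power_neq_1])
  ultimately show ?thesis
    \<comment> \<open>The difference is an integer polynomial, so the witnesses are
      \<open>?D\<close> over the denominator 1.\<close>
    unfolding ratfun_cong_def
    by (intro exI[of _ ?D] exI[of _ 1]) (simp add: to_fract_def)
qed

end
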